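(* Let $\delta$ be a given complex number, and let $E$ be a regular (a,b)-module equipped with an (a,b)-linear isomorphism $\kappa:\check E\to \mathrm{Hom}_{a,b}(E,E_\delta)$. Let $b_E$ and $b_E^*$ be the Bernstein-Sato polynomial and the dual Bernstein polynomial of $E$. Then $$b_E^*(z)=(-1)^r\,b_E(-\delta-z),\qquad\text{where } r:=\deg(b_E).$$
   Context: An (a,b)-module is a free $\mathbb{C}[[b]]$-module $E$ of finite rank with a $\mathbb{C}$-linear endomorphism $a$ satisfying $ab-ba=b^2$. (a,b)-linear maps are $\mathbb{C}[[b]]$-linear maps commuting with $a$. A sub-(a,b)-module is a $\mathbb{C}[[b]]$-submodule stable under $a$. $E$ has a simple pole if $aE\subset bE$. $E$ is regular if it embeds in a simple pole (a,b)-module; its saturation by $b^{-1}a$ is then $\tilde E=\sum_{k\ge0}(b^{-1}a)^kE\subset E[b^{-1}]$, the smallest simple pole (a,b)-module in $E[b^{-1}]$ containing $E$. Let $F$ be the biggest simple pole sub-(a,b)-module of $E$. The Bernstein-Sato polynomial $b_E$ is the minimal polynomial of $-b^{-1}a$ acting on the finite dimensional vector space $\tilde E/b\tilde E$. The dual Bernstein polynomial $b_E^*$ is the minimal polynomial of $-b^{-1}a$ acting on $F/bF$. $\check E$ denotes the (a,b)-module with the same underlying vector space as $E$, on which "$a$" and "$b$" act as $-a$ and $-b$. $E_\delta=\mathbb{C}[[b]]e_\delta$ is the rank one (a,b)-module with $a\,e_\delta=\delta\, b\,e_\delta$. For (a,b)-modules $E,G$, $\mathrm{Hom}_{a,b}(E,G)$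 is the $\mathbb{C}[[b]]$-module $\mathrm{Hom}_{\mathbb{C}[[b]]}(E,G)$ with the action $(a\cdot\varphi)(x)=a_G\varphi(x)-\varphi(a_Ex)$. *)

theory Defs
  imports
    "HOL-Algebra.Algebraic_Closure_Type"
    "HOL-Computational_Algebra.Computational_Algebra"
begin

section \<open>(a,b)-modules\<close>

text \<open>
  The ring \<open>\<complex>[[b]]\<close> is \<^typ>\<open>complex fps\<close>, with \<open>b\<close> the variable \<^const>\<open>fps_X\<close>. As modules in
  HOL-Algebra reuse the ring record, the fields \<open>mult\<close> and \<open>one\<close> of the structures below carry
  no meaning; they are left undefined.
\<close>

abbreviation Cb :: "complex fps ring"
  where "Cb \<equiv> ring_of_type_algebra"

record 'e ab_struct = "(complex fps, 'e) module" +
  aop :: "'e \<Rightarrow> 'e"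

definition bop :: "('e, 'm) ab_struct_scheme \<Rightarrow> 'e \<Rightarrow> 'e"
  where "bop M x = fps_X \<odot>\<^bsub>M\<^esub> x"

definition free_finite_rank :: "('e, 'm) ab_struct_scheme \<Rightarrow> bool"
  where "free_finite_rank M \<longleftrightarrow>
    (\<exists>B. finite B \<and> B \<subseteq> carrier M \<and>
      (\<forall>x\<in>carrier M. \<exists>!c. c \<in> B \<rightarrow>\<^sub>E carrier Cb \<and> x = (\<Oplus>\<^bsub>M\<^esub>v\<in>B. c v \<odot>\<^bsub>M\<^esub> v)))"

locale ab_module = module Cb M for M :: "('e, 'm) ab_struct_scheme" (structure) +
  assumes free: "free_finite_rank M"
    and aop_closed: "x \<in> carrier M \<Longrightarrow> aop M x \<in> carrier M"
    and aop_add: "\<lbrakk>x \<in> carrier M; y \<in> carrier M\<rbrakk> \<Longrightarrow> aop M (x \<oplus> y) = aop M x \<oplus> aop M y"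
    and aop_scale:
      "x \<in> carrier M \<Longrightarrow> aop M (fps_const c \<odot>\<^bsub>M\<^esub> x) = fps_const c \<odot>\<^bsub>M\<^esub> aop M x"
    and aop_bop:
      "x \<in> carrier M \<Longrightarrow> aop M (bop M x) \<ominus> bop M (aop M x) = bop M (bop M x)"

definition Cb_hom :: "('e, 'm) ab_struct_scheme \<Rightarrow> ('g, 'n) ab_struct_scheme \<Rightarrow> ('e \<Rightarrow> 'g) set"
  where "Cb_hom E G = {\<phi> \<in> carrier E \<rightarrow> carrier G.
    (\<forall>x\<in>carrier E. \<forall>y\<in>carrier E. \<phi> (x \<oplus>\<^bsub>E\<^esub> y) = \<phi> x \<oplus>\<^bsub>G\<^esub> \<phi> y) \<and>
    (\<forall>f. \<forall>x\<in>carrier E. \<phi> (f \<odot>\<^bsub>E\<^esub> x) = f \<odot>\<^bsub>G\<^esub> \<phi> x)}"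

definition ab_hom :: "('e, 'm) ab_struct_scheme \<Rightarrow> ('g, 'n) ab_struct_scheme \<Rightarrow> ('e \<Rightarrow> 'g) set"
  where "ab_hom E G = {\<phi> \<in> Cb_hom E G. \<forall>x\<in>carrier E. \<phi> (aop E x) = aop G (\<phi> x)}"

definition ab_iso :: "('e, 'm) ab_struct_scheme \<Rightarrow> ('g, 'n) ab_struct_scheme \<Rightarrow> ('e \<Rightarrow> 'g) set"
  where "ab_iso E G = {\<phi> \<in> ab_hom E G. bij_betw \<phi> (carrier E) (carrier G)}"

definition sub_ab_module :: "'e set \<Rightarrow> ('e, 'm) ab_struct_scheme \<Rightarrow> bool"
  where "sub_ab_module N E \<longleftrightarrow> submodule N Cb E \<and> aop E ` N \<subseteq> N"

definition simple_pole :: "('e, 'm) ab_struct_scheme \<Rightarrow> bool"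
  where "simple_pole E \<longleftrightarrow> aop E ` carrier E \<subseteq> bop E ` carrier E"

text \<open>
  Regularity quantifies over all simple pole (a,b)-modules. By taking coordinates in a basis, each
  of them is isomorphic to one whose elements have type \<^typ>\<open>nat \<Rightarrow> complex fps\<close>, so it is enough
  to quantify over that type; see \<open>regularI\<close> below.
\<close>

definition regular :: "('e, 'm) ab_struct_scheme \<Rightarrow> bool"
  where "regular E \<longleftrightarrow> (\<exists>G :: (nat \<Rightarrow> complex fps) ab_struct. ab_module G \<and> simple_pole G \<and>
    (\<exists>\<phi>\<in>ab_hom E G. inj_on \<phi> (carrier E)))"


section \<open>Constructions\<close>

text \<open>Since \<open>b\<close> acts as \<open>-b\<close>, the series \<open>f(b)\<close> acts as \<open>f(-b)\<close>.\<close>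

definition check :: "('e, 'm) ab_struct_scheme \<Rightarrow> ('e, 'm) ab_struct_scheme"
  where "check E = E\<lparr>module.smult := \<lambda>f x. fps_compose f (- fps_X) \<odot>\<^bsub>E\<^esub> x, aop := \<lambda>x. \<ominus>\<^bsub>E\<^esub> aop E x\<rparr>"

text \<open>
  The elements \<open>f e\<^sub>\<delta>\<close> of \<open>E\<^sub>\<delta>\<close> are represented by \<open>f\<close>. The commutation rule \<open>a b - b a = b\<^sup>2\<close>
  gives \<open>a f = f a + b\<^sup>2 f'\<close>, so that \<open>a (f e\<^sub>\<delta>) = (\<delta> b f + b\<^sup>2 f') e\<^sub>\<delta>\<close>.
\<close>

definition E_rank1 :: "complex \<Rightarrow> complex fps ab_struct"
  where "E_rank1 \<delta> = \<lparr>carrier = UNIV, monoid.mult = undefined, one = undefined, zero = 0, add = (+),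
    module.smult = (*), aop = (\<lambda>f. fps_const \<delta> * fps_X * f + fps_X\<^sup>2 * fps_deriv f)\<rparr>"

definition Hom_ab ::
    "('e, 'm) ab_struct_scheme \<Rightarrow> ('g, 'n) ab_struct_scheme \<Rightarrow> ('e \<Rightarrow> 'g) ab_struct"
  where "Hom_ab E G = \<lparr>carrier = Cb_hom E G \<inter> extensional (carrier E),
    monoid.mult = undefined, one = undefined,
    zero = (\<lambda>x\<in>carrier E. \<zero>\<^bsub>G\<^esub>),
    add = (\<lambda>\<phi> \<psi>. \<lambda>x\<in>carrier E. \<phi> x \<oplus>\<^bsub>G\<^esub> \<psi> x),
    module.smult = (\<lambda>f \<phi>. \<lambda>x\<in>carrier E. f \<odot>\<^bsub>G\<^esub> \<phi> x),
    aop = (\<lambda>\<phi>. \<lambda>x\<in>carrier E. aop G (\<phi> x) \<ominus>\<^bsub>G\<^esub> \<phi> (aop E x))\<rparr>"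

text \<open>
  \<open>E[b\<^sup>-\<^sup>1]\<close> consists of the fractions \<open>b\<^sup>-\<^sup>n x\<close>, represented by equivalence classes of pairs
  \<open>(x, n)\<close>; as \<open>E\<close> is free, \<open>b\<^sup>-\<^sup>n x = b\<^sup>-\<^sup>m y\<close> iff \<open>b\<^sup>m x = b\<^sup>n y\<close>. Operations on classes are
  given by unions over representatives, as for \<^const>\<open>rcoset_mult\<close>. The relation
  \<open>a b\<^sup>n = b\<^sup>n a + n b\<^sup>n\<^sup>+\<^sup>1\<close> forces \<open>a (b\<^sup>-\<^sup>n x) = b\<^sup>-\<^sup>n (a x - n b x)\<close>.
\<close>

definition loc_frac :: "('e, 'm) ab_struct_scheme \<Rightarrow> 'e \<Rightarrow> nat \<Rightarrow> ('e \<times> nat) set"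
  where "loc_frac E x n = {(y, m). y \<in> carrier E \<and> fps_X ^ m \<odot>\<^bsub>E\<^esub> x = fps_X ^ n \<odot>\<^bsub>E\<^esub> y}"

definition localization :: "('e, 'm) ab_struct_scheme \<Rightarrow> ('e \<times> nat) set ab_struct"
  where "localization E = \<lparr>carrier = {loc_frac E x n | x n. x \<in> carrier E},
    monoid.mult = undefined, one = undefined,
    zero = loc_frac E \<zero>\<^bsub>E\<^esub> 0,
    add = (\<lambda>S T. \<Union>(x, n)\<in>S. \<Union>(y, m)\<in>T.
      loc_frac E (fps_X ^ m \<odot>\<^bsub>E\<^esub> x \<oplus>\<^bsub>E\<^esub> fps_X ^ n \<odot>\<^bsub>E\<^esub> y) (n + m)),
    module.smult = (\<lambda>f S. \<Union>(x, n)\<in>S. loc_frac E (f \<odot>\<^bsub>E\<^esub> x) n),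
    aop = (\<lambda>S. \<Union>(x, n)\<in>S. loc_frac E (aop E x \<ominus>\<^bsub>E\<^esub> of_nat n \<odot>\<^bsub>E\<^esub> bop E x) n)\<rparr>"

text \<open>
  The operator \<open>b\<^sup>-\<^sup>1 a\<close>, meaningful when \<open>b\<close> is injective and its image contains that of \<open>a\<close>:
  on \<open>E[b\<^sup>-\<^sup>1]\<close> and on simple pole (a,b)-modules.
\<close>

definition binva :: "('e, 'm) ab_struct_scheme \<Rightarrow> 'e \<Rightarrow> 'e"
  where "binva M x = (THE y. y \<in> carrier M \<and> bop M y = aop M x)"

text \<open>The saturation \<open>\<Sum>\<^sub>k (b\<^sup>-\<^sup>1 a)\<^sup>k E\<close>, where \<open>x \<in> E\<close> is identified with the fraction \<open>b\<^sup>0 x\<close>.\<close>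

definition saturation :: "('e, 'm) ab_struct_scheme \<Rightarrow> ('e \<times> nat) set ab_struct"
  where "saturation E = (localization E)\<lparr>carrier :=
    {\<Oplus>\<^bsub>localization E\<^esub>k\<in>{..n}. (binva (localization E) ^^ k) (loc_frac E (x k) 0) | n x.
      \<forall>k::nat. x k \<in> carrier E}\<rparr>"

definition biggest_simple_pole :: "('e, 'm) ab_struct_scheme \<Rightarrow> ('e, 'm) ab_struct_scheme"
  where "biggest_simple_pole E = E\<lparr>carrier :=
    (GREATEST N. sub_ab_module N E \<and> simple_pole (E\<lparr>carrier := N\<rparr>))\<rparr>"


section \<open>Bernstein polynomials\<close>

definition annihilates :: "(complex, 'v, 'n) module_scheme \<Rightarrow> ('v \<Rightarrow> 'v) \<Rightarrow> complex poly \<Rightarrow> bool"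
  where "annihilates V T p \<longleftrightarrow>
    (\<forall>v\<in>carrier V. (\<Oplus>\<^bsub>V\<^esub>i\<in>{..degree p}. coeff p i \<odot>\<^bsub>V\<^esub> (T ^^ i) v) = \<zero>\<^bsub>V\<^esub>)"

text \<open>The monic generator of the ideal of polynomials annihilating \<open>T\<close>.\<close>

definition minimal_poly :: "(complex, 'v, 'n) module_scheme \<Rightarrow> ('v \<Rightarrow> 'v) \<Rightarrow> complex poly"
  where "minimal_poly V T = (THE p. lead_coeff p = 1 \<and> (\<forall>q. annihilates V T q \<longleftrightarrow> p dvd q))"

text \<open>The complex vector space \<open>M/bM\<close>, its elements being cosets.\<close>

definition mod_b :: "('e, 'm) ab_struct_scheme \<Rightarrow> (complex, 'e set) module"
  where "mod_b M = (let N = bop M ` carrier M in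
    \<lparr>carrier = a_rcosets\<^bsub>M\<^esub> N, monoid.mult = undefined, one = undefined, zero = N, add = set_add M,
     module.smult = (\<lambda>c S. \<Union>x\<in>S. N +>\<^bsub>M\<^esub> (fps_const c \<odot>\<^bsub>M\<^esub> x))\<rparr>)"

definition induced_mod_b :: "('e, 'm) ab_struct_scheme \<Rightarrow> ('e \<Rightarrow> 'e) \<Rightarrow> 'e set \<Rightarrow> 'e set"
  where "induced_mod_b M T S = (\<Union>x\<in>S. bop M ` carrier M +>\<^bsub>M\<^esub> T x)"

definition residue_poly :: "('e, 'm) ab_struct_scheme \<Rightarrow> complex poly"
  where "residue_poly M = minimal_poly (mod_b M) (induced_mod_b M (\<lambda>x. \<ominus>\<^bsub>M\<^esub> binva M x))"

definition bernstein_poly :: "('e, 'm) ab_struct_scheme \<Rightarrow> complex poly"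
  where "bernstein_poly E = residue_poly (saturation E)"

definition dual_bernstein_poly :: "('e, 'm) ab_struct_scheme \<Rightarrow> complex poly"
  where "dual_bernstein_poly E = residue_poly (biggest_simple_pole E)"


section \<open>Regularity does not depend on the type of the ambient module\<close>

lemma (in ab_module) transport:
  fixes h :: "'e \<Rightarrow> 'g"
  assumes inj: "inj_on h (carrier M)"
  shows "\<exists>G :: 'g ab_struct. ab_module G \<and> h \<in> ab_iso M G"
proof -
  define g where "g = inv_into (carrier M) h"
  have gh [simp]: "g (h x) = x" if "x \<in> carrier M" for x
    unfolding g_def using inj that by simp
  define G :: "'g ab_struct" where "G = \<lparr>carrier = h ` carrier M, monoid.mult = undefined,
    one = undefined, zero = h \<zero>, add = (\<lambda>u v. h (g u \<oplus> g v)),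
    module.smult = (\<lambda>f u. h (f \<odot>\<^bsub>M\<^esub> g u)), aop = (\<lambda>u. h (aop M (g u)))\<rparr>"
  have G [simp]: "carrier G = h ` carrier M" "\<zero>\<^bsub>G\<^esub> = h \<zero>"
    "u \<oplus>\<^bsub>G\<^esub> v = h (g u \<oplus> g v)" "f \<odot>\<^bsub>G\<^esub> u = h (f \<odot>\<^bsub>M\<^esub> g u)"
    "aop G u = h (aop M (g u))" for u v f
    by (simp_all add: G_def)
  have Cb [simp]: "carrier Cb = UNIV" "\<one>\<^bsub>Cb\<^esub> = 1" "f \<oplus>\<^bsub>Cb\<^esub> k = f + k" "f \<otimes>\<^bsub>Cb\<^esub> k = f * k" for f k
    by (simp_all add: ring_of_type_algebra_def)
  have sc [simp]: "f \<odot>\<^bsub>M\<^esub> x \<in> carrier M" if "x \<in> carrier M" for f x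
    using that smult_closed by simp
  have ac [simp]: "aop M x \<in> carrier M" if "x \<in> carrier M" for x
    using that by (rule aop_closed)
  have ag: "abelian_group G"
  proof (rule abelian_groupI)
    fix x assume "x \<in> carrier G"
    then obtain y where y: "x = h y" "y \<in> carrier M" by auto
    show "\<exists>z\<in>carrier G. z \<oplus>\<^bsub>G\<^esub> x = \<zero>\<^bsub>G\<^esub>"
      by (rule bexI[of _ "h (\<ominus> y)"]) (use y in \<open>auto simp: M.l_neg\<close>)
  qed (auto simp: M.a_ac)
  have mod: "module Cb G"
  proof (rule moduleI)
    show "cring Cb" by (rule R.cring_axioms)
    show "abelian_group G" by (rule ag)
  qed (use smult_l_distr smult_r_distr smult_assoc1 smult_one in auto)
  interpret G: module Cb G by (rule mod)
  have h_add: "h (x \<oplus> y) = h x \<oplus>\<^bsub>G\<^esub> h y" if "x \<in> carrier M" "y \<in> carrier M" for x y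
    using that by simp
  have h_sum: "h (finsum M F A) = finsum G (\<lambda>i. h (F i)) A"
    if "finite A" "F \<in> A \<rightarrow> carrier M" for F :: "'e \<Rightarrow> 'e" and A
    using that
  proof (induction A rule: finite_induct)
    case (insert a A)
    have "finsum G (\<lambda>i. h (F i)) (insert a A) = h (F a) \<oplus>\<^bsub>G\<^esub> finsum G (\<lambda>i. h (F i)) A"
      by (rule G.finsum_insert) (use insert in auto)
    moreover have "finsum M F (insert a A) = F a \<oplus> finsum M F A"
      by (rule M.finsum_insert) (use insert in auto)
    moreover have "F a \<in> carrier M" "finsum M F A \<in> carrier M"
      using insert by (auto intro: M.finsum_closed)
    moreover have "h (finsum M F A) = finsum G (\<lambda>i. h (F i)) A"
      using insert by auto
    ultimately show ?case by (simp only: h_add)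
  qed simp
  have minus: "h x \<ominus>\<^bsub>G\<^esub> h y = h (x \<ominus> y)" if "x \<in> carrier M" "y \<in> carrier M" for x y
  proof -
    have "h (\<ominus> y) = \<ominus>\<^bsub>G\<^esub> h y"
      by (rule G.minus_equality[symmetric]) (use that in \<open>auto simp: M.l_neg\<close>)
    then show ?thesis
      using that by (simp add: a_minus_def del: G(3)) (simp add: h_add del: G(3))
  qed
  have "free_finite_rank G"
  proof -
    obtain B where B: "finite B" "B \<subseteq> carrier M"
      and ex: "\<And>x. x \<in> carrier M \<Longrightarrow> \<exists>!c. c \<in> B \<rightarrow>\<^sub>E UNIV \<and> x = (\<Oplus>v\<in>B. c v \<odot>\<^bsub>M\<^esub> v)"
      using free unfolding free_finite_rank_def Cb by (elim exE conjE) (rule that, assumption+, erule bspec)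
    have injB: "inj_on h B" using inj B(2) by (rule inj_on_subset)
    have sum_eq: "(\<Oplus>\<^bsub>G\<^esub>v\<in>h ` B. c v \<odot>\<^bsub>G\<^esub> v) = h (\<Oplus>v\<in>B. c (h v) \<odot>\<^bsub>M\<^esub> v)" for c
    proof -
      have "(\<Oplus>\<^bsub>G\<^esub>v\<in>h ` B. c v \<odot>\<^bsub>G\<^esub> v) = (\<Oplus>\<^bsub>G\<^esub>v\<in>B. c (h v) \<odot>\<^bsub>G\<^esub> h v)"
        by (rule G.finsum_reindex[OF _ injB]) (use B in auto)
      also have "\<dots> = (\<Oplus>\<^bsub>G\<^esub>v\<in>B. h (c (h v) \<odot>\<^bsub>M\<^esub> v))"
        by (rule G.finsum_cong') (use B in auto)
      also have "\<dots> = h (\<Oplus>v\<in>B. c (h v) \<odot>\<^bsub>M\<^esub> v)"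
        by (rule h_sum[symmetric]) (use B in auto)
      finally show ?thesis .
    qed
    have closed: "(\<Oplus>v\<in>B. c v \<odot>\<^bsub>M\<^esub> v) \<in> carrier M" for c
      by (rule M.finsum_closed) (use B in auto)
    have "\<exists>!c. c \<in> h ` B \<rightarrow>\<^sub>E UNIV \<and> u = (\<Oplus>\<^bsub>G\<^esub>v\<in>h ` B. c v \<odot>\<^bsub>G\<^esub> v)" if u: "u \<in> carrier G" for u
    proof -
      obtain x where x: "u = h x" "x \<in> carrier M" using u by auto
      have eq: "u = (\<Oplus>\<^bsub>G\<^esub>v\<in>h ` B. c v \<odot>\<^bsub>G\<^esub> v) \<longleftrightarrow> x = (\<Oplus>v\<in>B. c (h v) \<odot>\<^bsub>M\<^esub> v)" for c
        unfolding sum_eq x(1) using inj_on_eq_iff[OF inj x(2) closed[of "\<lambda>v. c (h v)"]] .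
      obtain c where c: "c \<in> B \<rightarrow>\<^sub>E UNIV" "x = (\<Oplus>v\<in>B. c v \<odot>\<^bsub>M\<^esub> v)"
        and uniq: "\<And>d. d \<in> B \<rightarrow>\<^sub>E UNIV \<Longrightarrow> x = (\<Oplus>v\<in>B. d v \<odot>\<^bsub>M\<^esub> v) \<Longrightarrow> d = c"
        using ex[OF x(2)] by blast
      show ?thesis
      proof (rule ex1I[of _ "\<lambda>w\<in>h ` B. c (g w)"], unfold eq)
        have "(\<Oplus>v\<in>B. (\<lambda>w\<in>h ` B. c (g w)) (h v) \<odot>\<^bsub>M\<^esub> v) = (\<Oplus>v\<in>B. c v \<odot>\<^bsub>M\<^esub> v)"
          by (rule M.finsum_cong') (use B(2) in auto)
        then show "(\<lambda>w\<in>h ` B. c (g w)) \<in> h ` B \<rightarrow>\<^sub>E UNIV \<and>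
            x = (\<Oplus>v\<in>B. (\<lambda>w\<in>h ` B. c (g w)) (h v) \<odot>\<^bsub>M\<^esub> v)"
          using c(2) by auto
      next
        fix d assume d: "d \<in> h ` B \<rightarrow>\<^sub>E UNIV \<and> x = (\<Oplus>v\<in>B. d (h v) \<odot>\<^bsub>M\<^esub> v)"
        have "(\<Oplus>v\<in>B. (\<lambda>v\<in>B. d (h v)) v \<odot>\<^bsub>M\<^esub> v) = (\<Oplus>v\<in>B. d (h v) \<odot>\<^bsub>M\<^esub> v)"
          by (rule M.finsum_cong') (use B(2) in auto)
        then have dc: "(\<lambda>v\<in>B. d (h v)) = c"
          using d by (intro uniq) auto
        show "d = (\<lambda>w\<in>h ` B. c (g w))"
        proof
          fix w show "d w = (\<lambda>w\<in>h ` B. c (g w)) w"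
            using d B(2) unfolding dc[symmetric]
            by (cases "w \<in> h ` B") (auto simp: PiE_def extensional_def)
        qed
      qed
    qed
    moreover have "finite (h ` B)" "h ` B \<subseteq> carrier G" using B by auto
    ultimately show ?thesis
      unfolding free_finite_rank_def Cb by (intro exI[of _ "h ` B"] conjI ballI)
  qed
  moreover have "aop G (bop G u) \<ominus>\<^bsub>G\<^esub> bop G (aop G u) = bop G (bop G u)"
    if "u \<in> carrier G" for u
    using that aop_bop by (auto simp: bop_def minus)
  ultimately have "ab_module G"
    using aop_add aop_scale mod by (intro ab_module.intro ab_module_axioms.intro) auto
  moreover have "h \<in> ab_iso M G"
    using inj by (auto simp: ab_iso_def ab_hom_def Cb_hom_def bij_betw_def)
  ultimately show ?thesis by blast
qed

lemma (in ab_module) embeds_nat: "\<exists>h :: 'e \<Rightarrow> nat \<Rightarrow> complex fps. inj_on h (carrier M)"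
proof -
  obtain B where B: "finite B" "B \<subseteq> carrier M"
    and ex: "\<And>x. x \<in> carrier M \<Longrightarrow>
      \<exists>!c. c \<in> B \<rightarrow>\<^sub>E carrier Cb \<and> x = (\<Oplus>v\<in>B. c v \<odot>\<^bsub>M\<^esub> v)"
    using free unfolding free_finite_rank_def
    by (elim exE conjE) (rule that, assumption+, erule bspec)
  have "\<forall>x\<in>carrier M. \<exists>c. c \<in> extensional B \<and> x = (\<Oplus>v\<in>B. c v \<odot>\<^bsub>M\<^esub> v)"
    using ex unfolding PiE_def by blast
  then obtain c where c: "\<And>x. x \<in> carrier M \<Longrightarrow> c x \<in> extensional B"
    "\<And>x. x \<in> carrier M \<Longrightarrow> x = (\<Oplus>v\<in>B. c x v \<odot>\<^bsub>M\<^esub> v)"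
    by metis
  obtain i :: "'e \<Rightarrow> nat" where i: "inj_on i B"
    using finite_imp_inj_to_nat_seg[OF B(1)] by blast
  have "x = y" if "x \<in> carrier M" "y \<in> carrier M"
    and eq: "(\<lambda>k. c x (inv_into B i k)) = (\<lambda>k. c y (inv_into B i k))" for x y
  proof -
    have "c x v = c y v" if "v \<in> B" for v
      using fun_cong[OF eq, of "i v"] that i by simp
    then have "c x = c y" using c(1) that(1,2) by (intro extensionalityI[of _ B]) auto
    then show ?thesis using c(2) that(1,2) by metis
  qed
  then show ?thesis
    by (intro exI[of _ "\<lambda>x k. c x (inv_into B i k)"] inj_onI)
qed

lemma regularI:
  fixes G :: "('g, 'n) ab_struct_scheme"
  assumes G: "ab_module G" "simple_pole G"
    and \<phi>: "\<phi> \<in> ab_hom E G" "inj_on \<phi> (carrier E)"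
  shows "regular E"
proof -
  interpret G: ab_module G by fact
  obtain h :: "'g \<Rightarrow> nat \<Rightarrow> complex fps" where h: "inj_on h (carrier G)"
    using G.embeds_nat by blast
  then obtain H :: "(nat \<Rightarrow> complex fps) ab_struct" where H: "ab_module H" "h \<in> ab_iso G H"
    using G.transport by blast
  have hh: "h \<in> ab_hom G H" and hG: "h ` carrier G = carrier H"
    using H(2) unfolding ab_iso_def bij_betw_def by blast+
  have hs: "h (bop G x) = bop H (h x)" "h (aop G x) = aop H (h x)" if "x \<in> carrier G" for x
    using hh that unfolding ab_hom_def Cb_hom_def bop_def by blast+
  have "simple_pole H"
    unfolding simple_pole_def
  proof
    fix u assume "u \<in> aop H ` carrier H"
    then obtain x where x: "x \<in> carrier G" "u = aop H (h x)" unfolding hG[symmetric] by blast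
    have "aop G x \<in> bop G ` carrier G" using G(2) x(1) unfolding simple_pole_def by blast
    then obtain y where y: "aop G x = bop G y" "y \<in> carrier G" by (rule imageE)
    have "u = bop H (h y)" using x(2) hs(1)[OF y(2)] hs(2)[OF x(1)] y(1) by simp
    moreover have "h y \<in> carrier H" unfolding hG[symmetric] using y(2) by (rule imageI)
    ultimately show "u \<in> bop H ` carrier H" by (rule image_eqI)
  qed
  moreover have "h \<circ> \<phi> \<in> ab_hom E H"
    using \<phi>(1) hh unfolding ab_hom_def Cb_hom_def by (simp add: Pi_iff)
  moreover have "\<phi> ` carrier E \<subseteq> carrier G"
    using \<phi>(1) unfolding ab_hom_def Cb_hom_def by blast
  then have "inj_on (h \<circ> \<phi>) (carrier E)"
    by (intro comp_inj_on[OF \<phi>(2)] inj_on_subset[OF h])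
  ultimately show ?thesis unfolding regular_def using H(1) by (intro exI[of _ H] conjI bexI)
qed

end

theory Submission
  imports Defs
begin

text \<open>
  The isomorphism \<open>\<kappa>\<close> is a perfect pairing \<open>\<langle>x, y\<rangle> = \<kappa>(x)(y)\<close> on \<open>E\<close>, sesquilinear for
  \<open>b \<mapsto> -b\<close>. Extended to \<open>E[b\<^sup>-\<^sup>1]\<close>, it satisfies
  \<open>\<langle>b\<^sup>-\<^sup>1a x, y\<rangle> + \<langle>x, b\<^sup>-\<^sup>1a y\<rangle> = \<delta> \<langle>x, y\<rangle> + b \<langle>x, y\<rangle>'\<close>, so the dual lattice of a simple pole lattice
  has a simple pole. Hence the biggest simple pole submodule \<open>F\<close> is the dual of the saturation
  \<open>E\<^sup>~\<close>, and the pairing induces a perfect complex bilinear pairing of \<open>F/bF\<close> with \<open>E\<^sup>~/bE\<^sup>~\<close>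
  for which \<open>-b\<^sup>-\<^sup>1a\<close> on \<open>F/bF\<close> is adjoint to \<open>-\<delta> - (-b\<^sup>-\<^sup>1a)\<close> on \<open>E\<^sup>~/bE\<^sup>~\<close>. Adjoint endomorphisms
  have the same minimal polynomial.
\<close>

text \<open>No dimension is counted and no basis of the quotients is chosen. The pairing is kept as
  a complex-valued form on the modules themselves, with kernels \<open>bF\<close> on one side and
  \<open>b\<close> times the saturation on the other, so that a polynomial in the operator is tested
  only through the numbers it produces. Setting \<open>b = 0\<close> removes two complications:
  \<open>f(b)\<close> and \<open>f(-b)\<close> have the same constant term, which turns sesquilinear
  into bilinear, and the derivative term drops out. The inclusion of every simple pole submodule in
  the dual lattice is the elementary half: integrality of the pairing propagates along
  \<open>b^-1 a\<close>, which generates the saturation from E. The delicate half is that no element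
  of the saturation outside its multiples of \<open>b\<close> is orthogonal modulo \<open>b\<close>
  to \<open>F\<close>. It needs enough functionals on the saturation, and this is where regularity
  enters: the saturation embeds in a simple pole module of finite rank and therefore has a dual
  basis over C[[b]].\<close>

section \<open>Linear functionals on polynomials\<close>

text \<open>If \<open>w k = \<beta>(T\<^sup>k v)\<close> for a linear functional \<open>\<beta>\<close>, then \<open>plin w q = \<beta>(q(T) v)\<close>.\<close>

definition plin :: "(nat \<Rightarrow> complex) \<Rightarrow> complex poly \<Rightarrow> complex"
  where "plin w q = (\<Sum>k\<le>degree q. coeff q k * w k)"

lemma plin_upto:
  assumes "degree q \<le> n"
  shows "plin w q = (\<Sum>k\<le>n. coeff q k * w k)"
  unfolding plin_def
  by (rule sum.mono_neutral_left) (use assms in \<open>auto simp: coeff_eq_0\<close>)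

lemma plin_0 [simp]: "plin w 0 = 0"
  by (simp add: plin_def)

lemma plin_add: "plin w (p + q) = plin w p + plin w q"
proof -
  define n where "n = max (degree p) (degree q)"
  have "degree (p + q) \<le> n" "degree p \<le> n" "degree q \<le> n"
    unfolding n_def by (auto intro: degree_add_le)
  then show ?thesis
    by (simp add: plin_upto sum.distrib algebra_simps)
qed

lemma plin_smult: "plin w (Polynomial.smult c q) = c * plin w q"
  using plin_upto[of "Polynomial.smult c q" "degree q" w]
  by (simp add: degree_smult_le plin_def sum_distrib_left mult.assoc)

lemma plin_pCons: "plin w (pCons c q) = c * w 0 + plin (\<lambda>k. w (Suc k)) q"
proof -
  have "plin w (pCons c q) = (\<Sum>k\<le>Suc (degree q). coeff (pCons c q) k * w k)"
    by (rule plin_upto) (rule degree_pCons_le)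
  then show ?thesis
    by (simp add: sum.atMost_Suc_shift plin_def del: sum.atMost_Suc)
qed

lemma plin_add_left: "plin (\<lambda>k. w k + v k) q = plin w q + plin v q"
  by (simp add: plin_def sum.distrib algebra_simps)

lemma plin_smult_left: "plin (\<lambda>k. c * w k) q = c * plin w q"
  by (simp add: plin_def sum_distrib_left mult_ac)

lemma plin_sum_left: "plin (\<lambda>k. \<Sum>i\<in>I. f i k) q = (\<Sum>i\<in>I. plin (f i) q)"
  unfolding plin_def sum_distrib_left by (rule sum.swap)

text \<open>This takes the place of a dimension count: it yields a polynomial annihilating a vector
  that has finitely many coordinates. The prescribed lower bound on the degree carries the
  induction: two solutions of different degrees combine to kill one more functional, and their
  combination cannot be zero.\<close>

lemma plin_common_kernel:
  fixes w :: "'i \<Rightarrow> nat \<Rightarrow> complex"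
  assumes "finite I"
  shows "\<exists>q. q \<noteq> 0 \<and> N \<le> degree q \<and> (\<forall>i\<in>I. plin (w i) q = 0)"
  using assms
proof (induction I arbitrary: N rule: finite_induct)
  case empty
  show ?case
    by (rule exI[of _ "monom 1 N"]) (simp add: degree_monom_eq)
next
  case (insert j I)
  obtain q1 where q1: "q1 \<noteq> 0" "N \<le> degree q1" "\<forall>i\<in>I. plin (w i) q1 = 0"
    using insert.IH by blast
  obtain q2 where q2: "q2 \<noteq> 0" "Suc (degree q1) \<le> degree q2" "\<forall>i\<in>I. plin (w i) q2 = 0"
    using insert.IH by blast
  show ?case
  proof (cases "plin (w j) q1 = 0")
    case True
    then show ?thesis using q1 by blast
  next
    case False
    define c where "c = - (plin (w j) q2 / plin (w j) q1)"
    define q where "q = q2 + Polynomial.smult c q1"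
    have "degree (Polynomial.smult c q1) < degree q2"
      using degree_smult_le[of c q1] q2(2) by linarith
    then have "degree q = degree q2"
      unfolding q_def by (rule degree_add_eq_left)
    moreover have "plin (w j) q = 0"
      unfolding q_def plin_add plin_smult using False by (simp add: c_def)
    moreover have "\<forall>i\<in>I. plin (w i) q = 0"
      using q1 q2 by (simp add: q_def plin_add plin_smult)
    ultimately show ?thesis
      using q1 q2 by (intro exI[of _ q]) auto
  qed
qed

section \<open>Annihilator ideals and their monic generators\<close>

lemma poly_ideal_generator:
  fixes J :: "complex poly set"
  assumes add: "\<And>p q. p \<in> J \<Longrightarrow> q \<in> J \<Longrightarrow> p + q \<in> J"
    and mult: "\<And>p q. p \<in> J \<Longrightarrow> q * p \<in> J"
    and nontriv: "\<exists>p\<in>J. p \<noteq> 0"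
  shows "\<exists>p. lead_coeff p = 1 \<and> (\<forall>q. q \<in> J \<longleftrightarrow> p dvd q)"
proof -
  obtain p where p: "p \<in> J" "p \<noteq> 0" and min: "\<And>q. q \<in> J \<Longrightarrow> q \<noteq> 0 \<Longrightarrow> degree p \<le> degree q"
    using nontriv ex_has_least_nat[of "\<lambda>p. p \<in> J \<and> p \<noteq> 0" _ degree] by blast
  have "q \<in> J \<longleftrightarrow> p dvd q" for q
  proof
    assume "q \<in> J"
    have "q mod p = q + (- (q div p)) * p"
      by (simp add: minus_mult_div_eq_mod[symmetric])
    then have "q mod p \<in> J"
      using add[OF \<open>q \<in> J\<close> mult[OF p(1), of "- (q div p)"]] by simp
    then have "q mod p = 0"
      using min[of "q mod p"] degree_mod_less[OF p(2), of q] by (meson not_le)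
    then show "p dvd q" by auto
  next
    assume "p dvd q"
    then obtain k where "q = k * p" by (metis dvdE mult.commute)
    then show "q \<in> J" using mult p(1) by blast
  qed
  moreover have "lead_coeff (Polynomial.smult (inverse (lead_coeff p)) p) = 1"
    using p(2) by simp
  moreover have "Polynomial.smult (inverse (lead_coeff p)) p dvd q \<longleftrightarrow> p dvd q" for q
    using p(2) by (simp add: smult_dvd_iff)
  ultimately show ?thesis
    by (intro exI[of _ "Polynomial.smult (inverse (lead_coeff p)) p"]) simp
qed

text \<open>Monic polynomials that divide each other are equal, so the description in
  \<open>minimal_poly\<close> is settled by any monic generator of the annihilators.\<close>

lemma minimal_poly_eqI:
  assumes "lead_coeff p = 1" and "\<And>q. annihilates V T q \<longleftrightarrow> p dvd q"
  shows "minimal_poly V T = p"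
  unfolding minimal_poly_def
proof (rule the_equality)
  fix p' assume p': "lead_coeff p' = 1 \<and> (\<forall>q. annihilates V T q \<longleftrightarrow> p' dvd q)"
  then have "p dvd p'" "p' dvd p" using assms(2)[of p'] assms(2)[of p] by simp_all
  moreover have "p \<noteq> 0" "p' \<noteq> 0" using assms(1) p' by auto
  moreover obtain k where k: "p' = p * k" using \<open>p dvd p'\<close> by (elim dvdE)
  ultimately have "degree k = 0"
    using dvd_imp_degree_le[of p' p] degree_mult_eq[of p k] by auto
  then obtain c where "k = [:c:]" by (elim degree_eq_zeroE)
  moreover from this have "c = 1" using k p' assms(1) by (simp split: if_splits)
  ultimately show "p' = p" using k by simp
qed (simp add: assms)

text \<open>Origin of the sign \<open>(-1)^r\<close>: it makes the reflected polynomial monic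
  again.\<close>

lemma lead_coeff_pcompose_reflect:
  "lead_coeff (pcompose p [:c, - 1:]) = lead_coeff p * (- 1) ^ degree (p :: complex poly)"
  by (subst lead_coeff_comp) simp_all

section \<open>Modules over formal power series\<close>

lemma Cb_simps [simp]:
  "carrier Cb = UNIV" "\<one>\<^bsub>Cb\<^esub> = 1" "\<zero>\<^bsub>Cb\<^esub> = 0" "f \<oplus>\<^bsub>Cb\<^esub> g = f + g" "f \<otimes>\<^bsub>Cb\<^esub> g = f * g"
  by (simp_all add: ring_of_type_algebra_def)

text \<open>Separate from \<open>ab_module\<close> because the results are also applied to E[b^-1],
  which has no finite basis over C[[b]] unless it is zero.\<close>

locale Cb_module = module Cb M for M :: "('e, 'm) ab_struct_scheme" (structure)
begin

lemma sm_closed [simp]: "x \<in> carrier M \<Longrightarrow> f \<odot>\<^bsub>M\<^esub> x \<in> carrier M"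
  by simp

lemma sm_add: "x \<in> carrier M \<Longrightarrow> (f + g) \<odot>\<^bsub>M\<^esub> x = f \<odot>\<^bsub>M\<^esub> x \<oplus> g \<odot>\<^bsub>M\<^esub> x"
  using smult_l_distr[of f g x] by simp

lemma sm_add_r:
  "x \<in> carrier M \<Longrightarrow> y \<in> carrier M \<Longrightarrow> f \<odot>\<^bsub>M\<^esub> (x \<oplus> y) = f \<odot>\<^bsub>M\<^esub> x \<oplus> f \<odot>\<^bsub>M\<^esub> y"
  by (rule smult_r_distr) simp_all

lemma sm_assoc: "x \<in> carrier M \<Longrightarrow> f \<odot>\<^bsub>M\<^esub> (g \<odot>\<^bsub>M\<^esub> x) = (f * g) \<odot>\<^bsub>M\<^esub> x"
  using smult_assoc1[of f g x] by simp

lemma sm_one [simp]: "x \<in> carrier M \<Longrightarrow> 1 \<odot>\<^bsub>M\<^esub> x = x"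
  using smult_one[of x] by simp

lemma sm_0 [simp]: "x \<in> carrier M \<Longrightarrow> 0 \<odot>\<^bsub>M\<^esub> x = \<zero>"
  using smult_l_null[of x] by simp

lemma sm_zero [simp]: "f \<odot>\<^bsub>M\<^esub> \<zero> = \<zero>"
  by simp

lemma sm_neg_one: 
  assumes "x \<in> carrier M" shows "\<ominus> x = (- 1) \<odot>\<^bsub>M\<^esub> x"
proof (rule M.minus_equality)
  show "(- 1) \<odot>\<^bsub>M\<^esub> x \<oplus> x = \<zero>"
    using sm_add[OF assms, of "-1" 1] assms by simp
qed (use assms in auto)

lemma submodule_iff:
  "submodule H Cb M \<longleftrightarrow> H \<subseteq> carrier M \<and> \<zero> \<in> H \<and> (\<forall>x\<in>H. \<forall>y\<in>H. x \<oplus> y \<in> H) \<and>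
    (\<forall>f. \<forall>x\<in>H. f \<odot>\<^bsub>M\<^esub> x \<in> H)"
proof safe
  assume H: "submodule H Cb M"
  show "x \<in> carrier M" if "x \<in> H" for x using submoduleE(1)[OF H] that by auto
  show "x \<oplus> y \<in> H" if "x \<in> H" "y \<in> H" for x y using submoduleE(5)[OF H] that by auto
  show "f \<odot>\<^bsub>M\<^esub> x \<in> H" if "x \<in> H" for f x using submoduleE(4)[OF H] that by auto
  then have "0 \<odot>\<^bsub>M\<^esub> x \<in> H" if "x \<in> H" for x using that by blast
  then show "\<zero> \<in> H" using submoduleE(1,2)[OF H] by (metis sm_0 ex_in_conv subsetD)
next
  assume H: "H \<subseteq> carrier M" "\<zero> \<in> H" "\<forall>x\<in>H. \<forall>y\<in>H. x \<oplus> y \<in> H" "\<forall>f. \<forall>x\<in>H. f \<odot>\<^bsub>M\<^esub> x \<in> H"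
  show "submodule H Cb M"
    by (rule submoduleI) (use H sm_neg_one in auto)
qed

lemma additive_finsum:
  fixes B :: "'e \<Rightarrow> 'b :: comm_monoid_add"
  assumes "finite A" "f \<in> A \<rightarrow> carrier M"
    and add: "\<And>x y. x \<in> carrier M \<Longrightarrow> y \<in> carrier M \<Longrightarrow> B (x \<oplus> y) = B x + B y"
    and zero: "B \<zero> = 0"
  shows "B (\<Oplus>i\<in>A. f i) = (\<Sum>i\<in>A. B (f i))"
  using assms(1,2)
proof (induction A rule: finite_induct)
  case empty
  then show ?case using zero by simp
next
  case (insert a A)
  then have "(\<Oplus>i\<in>insert a A. f i) = f a \<oplus> (\<Oplus>i\<in>A. f i)"
    by (intro M.finsum_insert) auto
  then show ?case using insert by (simp add: add Pi_iff)
qed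

text \<open>The data of the dual basis lemma for projective modules: the \<open>s i\<close> generate
  \<open>S\<close> with coefficients depending linearly on the element. The values
  \<open>c i (s j)\<close> are not prescribed, so some \<open>s i\<close> may be zero.\<close>

definition dual_system :: "'i set \<Rightarrow> 'e set \<Rightarrow> ('i \<Rightarrow> 'e) \<Rightarrow> ('i \<Rightarrow> 'e \<Rightarrow> complex fps) \<Rightarrow> bool"
  where "dual_system I S s c \<longleftrightarrow> (\<forall>i\<in>I. s i \<in> S) \<and>
    (\<forall>i\<in>I. \<forall>x\<in>S. \<forall>y\<in>S. c i (x \<oplus> y) = c i x + c i y) \<and>
    (\<forall>i\<in>I. \<forall>x\<in>S. \<forall>f. c i (f \<odot>\<^bsub>M\<^esub> x) = f * c i x) \<and>
    (\<forall>x\<in>S. (\<Oplus>i\<in>I. c i x \<odot>\<^bsub>M\<^esub> s i) = x)"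

lemma dual_systemD:
  assumes "dual_system I S s c"
  shows "i \<in> I \<Longrightarrow> s i \<in> S"
    and "i \<in> I \<Longrightarrow> x \<in> S \<Longrightarrow> y \<in> S \<Longrightarrow> c i (x \<oplus> y) = c i x + c i y"
    and "i \<in> I \<Longrightarrow> x \<in> S \<Longrightarrow> c i (f \<odot>\<^bsub>M\<^esub> x) = f * c i x"
    and "x \<in> S \<Longrightarrow> (\<Oplus>i\<in>I. c i x \<odot>\<^bsub>M\<^esub> s i) = x"
  using assms unfolding dual_system_def by simp_all

text \<open>By induction on \<open>I\<close>: an element \<open>s\<close> at which \<open>\<pi> j\<close> has minimal order splits off, since \<open>\<pi> j s\<close>
  divides all values of \<open>\<pi> j\<close>; the complement is the kernel of \<open>\<pi> j\<close>.\<close>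

lemma ex_dual_system:
  fixes \<pi> :: "'i \<Rightarrow> 'e \<Rightarrow> complex fps"
  assumes "finite I" and "submodule S Cb M"
    and "\<And>i x y. i \<in> I \<Longrightarrow> x \<in> S \<Longrightarrow> y \<in> S \<Longrightarrow> \<pi> i (x \<oplus> y) = \<pi> i x + \<pi> i y"
    and "\<And>i f x. i \<in> I \<Longrightarrow> x \<in> S \<Longrightarrow> \<pi> i (f \<odot>\<^bsub>M\<^esub> x) = f * \<pi> i x"
    and "\<And>x. x \<in> S \<Longrightarrow> (\<And>i. i \<in> I \<Longrightarrow> \<pi> i x = 0) \<Longrightarrow> x = \<zero>"
  shows "\<exists>s c. dual_system I S s c"
  using assms
proof (induction I arbitrary: S rule: finite_induct)
  case empty
  then show ?case by (auto simp: dual_system_def)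
next
  case (insert j I)
  note S = insert.prems(1)[unfolded submodule_iff]
  note add = insert.prems(2) and scale = insert.prems(3) and inj = insert.prems(4)
  have carr: "x \<in> carrier M" if "x \<in> S" for x using S that by blast
  \<comment> \<open>Zero values are excluded because \<open>subdegree 0 = 0\<close> would make the
    minimum \<open>0\<close> whatever the orders of the nonzero values are.\<close>
  define k where "k = (LEAST k. \<exists>x\<in>S. \<pi> j x \<noteq> 0 \<and> subdegree (\<pi> j x) = k)"
  obtain s where s: "s \<in> S" and div: "\<And>x. x \<in> S \<Longrightarrow> \<pi> j s dvd \<pi> j x"
  proof (cases "\<exists>x\<in>S. \<pi> j x \<noteq> 0")
    case True
    then have "\<exists>k. \<exists>x\<in>S. \<pi> j x \<noteq> 0 \<and> subdegree (\<pi> j x) = k" by blast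
    from LeastI_ex[OF this] obtain s where s: "s \<in> S" "\<pi> j s \<noteq> 0" "subdegree (\<pi> j s) = k"
      unfolding k_def by blast
    have "\<pi> j s dvd \<pi> j x" if "x \<in> S" for x
    proof (cases "\<pi> j x = 0")
      case False
      then have "k \<le> subdegree (\<pi> j x)" unfolding k_def using that by (intro Least_le) blast
      then show ?thesis using s False by (simp add: fps_dvd_iff)
    qed simp
    then show ?thesis using that s by blast
  next
    case False
    \<comment> \<open>If \<open>\<pi> j\<close> vanishes on \<open>S\<close>, the zero element
      serves: \<open>r\<close> is then \<open>0 div 0 = 0\<close> and nothing is split off.\<close>
    then show ?thesis using that[of \<zero>] S by auto
  qed
  define r where "r x = \<pi> j x div \<pi> j s" for x
  have r: "r x * \<pi> j s = \<pi> j x" if "x \<in> S" for x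
    unfolding r_def using div[OF that] by simp
  have r_add: "r (x \<oplus> y) = r x + r y" if "x \<in> S" "y \<in> S" for x y
    unfolding r_def using that add[of j x y] div by (simp add: div_add)
  have r_scale: "r (f \<odot>\<^bsub>M\<^esub> x) = f * r x" if "x \<in> S" for x f
    unfolding r_def using that scale[of j x f] div by (simp add: div_mult_swap)
  \<comment> \<open>The projection to the kernel of \<open>\<pi> j\<close> along
    \<open>s\<close>.\<close>
  define p where "p x = x \<oplus> (- r x) \<odot>\<^bsub>M\<^esub> s" for x
  define S' where "S' = {x \<in> S. \<pi> j x = 0}"
  have pi0: "\<pi> i \<zero> = 0" if "i \<in> insert j I" for i
    using scale[of i \<zero> 0] S that by simp
  have S': "submodule S' Cb M"
    unfolding submodule_iff S'_def using S add[of j] scale[of j] pi0[of j] by auto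
  have pS: "p x \<in> S" if "x \<in> S" for x
    using that s S by (simp add: p_def)
  have pS': "p x \<in> S'" if "x \<in> S" for x
    using that s S pS[OF that] add[of j x "(- r x) \<odot>\<^bsub>M\<^esub> s"] scale[of j s "- r x"] r[OF that]
    by (simp add: S'_def p_def)
  have p_add: "p (x \<oplus> y) = p x \<oplus> p y" if "x \<in> S" "y \<in> S" for x y
  proof -
    have "- r (x \<oplus> y) = - r x + - r y" using r_add[OF that] by simp
    then have "(- r (x \<oplus> y)) \<odot>\<^bsub>M\<^esub> s = (- r x) \<odot>\<^bsub>M\<^esub> s \<oplus> (- r y) \<odot>\<^bsub>M\<^esub> s"
      by (simp only: sm_add[OF carr[OF s]])
    then show ?thesis
      unfolding p_def using carr[OF that(1)] carr[OF that(2)] carr[OF s] by (simp add: M.a_ac)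
  qed
  have p_scale: "p (f \<odot>\<^bsub>M\<^esub> x) = f \<odot>\<^bsub>M\<^esub> p x" if "x \<in> S" for x f
    unfolding p_def using carr[OF that] carr[OF s] r_scale[OF that]
    by (simp add: sm_add_r sm_assoc)
  have "\<exists>s c. dual_system I S' s c"
  proof (rule insert.IH[OF S'])
    fix x assume "x \<in> S'" "\<And>i. i \<in> I \<Longrightarrow> \<pi> i x = 0"
    then show "x = \<zero>" using inj[of x] unfolding S'_def by blast
  qed (use add scale in \<open>auto simp: S'_def\<close>)
  then obtain s' c' where sc: "dual_system I S' s' c'" by blast
  note s' = dual_systemD(1)[OF sc] and c' = dual_systemD(2,3)[OF sc] and gen = dual_systemD(4)[OF sc]
  define s2 where "s2 i = (if i = j then s else s' i)" for i
  define c2 where "c2 i x = (if i = j then r x else c' i (p x))" for i x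
  have s2: "s2 i \<in> S" if "i \<in> insert j I" for i
    using that s s' by (auto simp: s2_def S'_def)
  have "(\<Oplus>i\<in>insert j I. c2 i x \<odot>\<^bsub>M\<^esub> s2 i) = x" if "x \<in> S" for x
  proof -
    have ne: "i \<noteq> j" if "i \<in> I" for i using that insert.hyps by blast
    have "(\<Oplus>i\<in>insert j I. c2 i x \<odot>\<^bsub>M\<^esub> s2 i) = c2 j x \<odot>\<^bsub>M\<^esub> s2 j \<oplus> (\<Oplus>i\<in>I. c2 i x \<odot>\<^bsub>M\<^esub> s2 i)"
      using insert.hyps s2 carr by (intro M.finsum_insert) auto
    also have "(\<Oplus>i\<in>I. c2 i x \<odot>\<^bsub>M\<^esub> s2 i) = (\<Oplus>i\<in>I. c' i (p x) \<odot>\<^bsub>M\<^esub> s' i)"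
      using s' carr ne by (intro M.finsum_cong') (auto simp: c2_def s2_def S'_def)
    also have "\<dots> = p x" using gen[OF pS'[OF that]] by simp
    also have "c2 j x \<odot>\<^bsub>M\<^esub> s2 j \<oplus> p x = x \<oplus> (r x + (- r x)) \<odot>\<^bsub>M\<^esub> s"
      unfolding sm_add[OF carr[OF s]] p_def using carr[OF s] carr[OF that]
      by (simp add: c2_def s2_def M.a_ac)
    also have "\<dots> = x" using carr[OF s] carr[OF that] by simp
    finally show ?thesis .
  qed
  moreover have "c2 i (x \<oplus> y) = c2 i x + c2 i y" if "i \<in> insert j I" "x \<in> S" "y \<in> S" for i x y
    using that by (auto simp: c2_def r_add p_add c' pS')
  moreover have "c2 i (f \<odot>\<^bsub>M\<^esub> x) = f * c2 i x" if "i \<in> insert j I" "x \<in> S" for i f x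
    using that by (auto simp: c2_def r_scale p_scale c' pS')
  ultimately have "dual_system (insert j I) S s2 c2"
    unfolding dual_system_def using s2 by simp
  then show ?case by blast
qed

section \<open>The quotient modulo \<open>b\<close> and the operators induced on it\<close>

lemma bM_iff: "z \<in> bop M ` carrier M \<longleftrightarrow> (\<exists>x\<in>carrier M. z = fps_X \<odot>\<^bsub>M\<^esub> x)"
  by (auto simp: bop_def)

lemma abelian_subgroup_bM: "abelian_subgroup (bop M ` carrier M) M"
proof (rule abelian_subgroupI3)
  have "submodule (bop M ` carrier M) Cb M"
    unfolding submodule_iff
  proof (intro conjI allI ballI)
    show "\<zero> \<in> bop M ` carrier M" unfolding bM_iff by (rule bexI[of _ \<zero>]) auto
    show "x \<oplus> y \<in> bop M ` carrier M" if "x \<in> bop M ` carrier M" "y \<in> bop M ` carrier M" for x y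
      using that unfolding bM_iff by (metis sm_add_r M.a_closed)
    show "f \<odot>\<^bsub>M\<^esub> x \<in> bop M ` carrier M" if "x \<in> bop M ` carrier M" for f x
      using that unfolding bM_iff by (metis sm_assoc mult.commute sm_closed)
  qed (auto simp: bop_def)
  then show "additive_subgroup (bop M ` carrier M) M"
    unfolding submodule_def additive_subgroup_def by simp
qed (rule M.abelian_group_axioms)

lemma abelian_group_mod_b: "abelian_group (mod_b M)"
proof -
  interpret N: abelian_subgroup "bop M ` carrier M" M by (rule abelian_subgroup_bM)
  interpret Q: comm_group "M A_Mod (bop M ` carrier M)"
    by (rule N.a_factorgroup_is_comm_group)
  have [simp]: "carrier (M A_Mod (bop M ` carrier M)) = carrier (mod_b M)"
    "monoid.mult (M A_Mod (bop M ` carrier M)) = ring.add (mod_b M)"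
    "monoid.one (M A_Mod (bop M ` carrier M)) = ring.zero (mod_b M)"
    by (simp_all add: mod_b_def Let_def A_FactGroup_defs A_RCOSETS_def set_add_def)
  show ?thesis
    by (rule abelian_groupI)
      (use Q.m_closed Q.one_closed Q.m_assoc Q.m_comm Q.l_one Q.l_inv_ex in simp_all)
qed

text \<open>The operator \<open>-b^-1 a\<close> does not commute with \<open>b\<close>; it acts on
  cosets because it preserves \<open>bM\<close>, and \<open>T_b\<close> asks for just this.
  Afterwards all computations can be done with representatives.\<close>

lemma annihilates_mod_b:
  assumes T: "\<And>x. x \<in> carrier M \<Longrightarrow> T x \<in> carrier M"
    and T_add: "\<And>x y. x \<in> carrier M \<Longrightarrow> y \<in> carrier M \<Longrightarrow> T (x \<oplus> y) = T x \<oplus> T y"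
    and T_b: "\<And>x. x \<in> carrier M \<Longrightarrow> T (fps_X \<odot>\<^bsub>M\<^esub> x) \<in> bop M ` carrier M"
  shows "annihilates (mod_b M) (induced_mod_b M T) q \<longleftrightarrow>
    (\<forall>x\<in>carrier M. (\<Oplus>i\<in>{..Polynomial.degree q}. fps_const (poly.coeff q i) \<odot>\<^bsub>M\<^esub> (T ^^ i) x) \<in> bop M ` carrier M)"
proof -
  define N where "N = bop M ` carrier M"
  interpret N: abelian_subgroup N M unfolding N_def by (rule abelian_subgroup_bM)
  interpret Q: abelian_group "mod_b M" by (rule abelian_group_mod_b)
  have NM: "x \<in> carrier M" if "x \<in> N" for x using that N.a_subset by blast
  have Q_simps: "carrier (mod_b M) = a_rcosets N" "\<zero>\<^bsub>mod_b M\<^esub> = N"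
    "S \<oplus>\<^bsub>mod_b M\<^esub> S' = S <+> S'"
    "c \<odot>\<^bsub>mod_b M\<^esub> S = (\<Union>x\<in>S. N +> (fps_const c \<odot>\<^bsub>M\<^esub> x))" for S S' c
    by (simp_all add: mod_b_def Let_def N_def)
  have coset: "N +> x \<in> carrier (mod_b M)" if "x \<in> carrier M" for x
    unfolding Q_simps using M.a_rcosetsI[OF N.a_subset that] .
  have coset_E: "\<exists>x\<in>carrier M. S = N +> x" if "S \<in> carrier (mod_b M)" for S
    using that unfolding Q_simps A_RCOSETS_def' by auto
  \<comment> \<open>The union over a coset collapses to one coset as soon as \<open>g\<close> is
    additive and preserves \<open>N\<close>; this serves for \<open>T\<close> and for the scalars
    alike.\<close>
  have ind: "(\<Union>x\<in>N +> v. N +> g x) = N +> g v"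
    if v: "v \<in> carrier M" and g: "\<And>x. x \<in> carrier M \<Longrightarrow> g x \<in> carrier M"
      and g_add: "\<And>x y. x \<in> carrier M \<Longrightarrow> y \<in> carrier M \<Longrightarrow> g (x \<oplus> y) = g x \<oplus> g y"
      and gN: "\<And>x. x \<in> N \<Longrightarrow> g x \<in> N" for v g
  proof -
    have "N +> g x = N +> g v" if "x \<in> N +> v" for x
    proof -
      have "x \<in> (\<Union>h\<in>N. {h \<oplus> v})"
        using that unfolding a_r_coset_def' .
      then obtain h where h: "h \<in> N" "x = h \<oplus> v"
        by (elim UN_E) (simp only: singleton_iff)
      have "g x \<in> N +> g v"
        unfolding a_r_coset_def' h(2) g_add[OF NM[OF h(1)] v]
        by (rule UN_I[OF gN[OF h(1)]]) simp
      from N.a_repr_independence'[OF this g[OF v]] show ?thesis by simp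
    qed
    then show ?thesis using N.a_rcos_self[OF v] by blast
  qed
  have TN: "T x \<in> N" if "x \<in> N" for x
    using that T_b unfolding N_def bop_def by blast
  have ind_T: "induced_mod_b M T (N +> v) = N +> T v" if "v \<in> carrier M" for v
    unfolding induced_mod_b_def N_def[symmetric] by (rule ind) (use that T T_add TN in auto)
  have cN: "f \<odot>\<^bsub>M\<^esub> x \<in> N" if "x \<in> N" for x f
    using that unfolding N_def bM_iff by (metis sm_assoc mult.commute sm_closed)
  have ind_c: "c \<odot>\<^bsub>mod_b M\<^esub> (N +> v) = N +> (fps_const c \<odot>\<^bsub>M\<^esub> v)" if "v \<in> carrier M" for v c
    unfolding Q_simps by (rule ind) (use that cN sm_add_r in auto)
  have Tpow: "(T ^^ i) v \<in> carrier M" if "v \<in> carrier M" for v i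
    by (induction i) (use that T in auto)
  have ind_pow: "(induced_mod_b M T ^^ i) (N +> v) = N +> (T ^^ i) v" if "v \<in> carrier M" for v i
    by (induction i) (use that ind_T Tpow in auto)
  have ind_sum: "(\<Oplus>\<^bsub>mod_b M\<^esub>i\<in>A. N +> g i) = N +> (\<Oplus>i\<in>A. g i)"
    if "finite A" "g \<in> A \<rightarrow> carrier M" for A :: "nat set" and g
    using that
  proof (induction A rule: finite_induct)
    case empty
    then show ?case using N.a_rcos_const[OF N.zero_closed] by (simp add: Q_simps)
  next
    case (insert a A)
    have "(\<Oplus>i\<in>insert a A. g i) = g a \<oplus> (\<Oplus>i\<in>A. g i)"
      using insert by (intro M.finsum_insert) auto
    moreover have "(\<Oplus>\<^bsub>mod_b M\<^esub>i\<in>insert a A. N +> g i) = (N +> g a) \<oplus>\<^bsub>mod_b M\<^esub> (\<Oplus>\<^bsub>mod_b M\<^esub>i\<in>A. N +> g i)"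
      using insert coset by (intro Q.finsum_insert) auto
    moreover have "g a \<in> carrier M" "(\<Oplus>i\<in>A. g i) \<in> carrier M"
      using insert by (auto intro: M.finsum_closed)
    ultimately show ?case
      using insert by (simp add: Q_simps N.a_rcos_sum)
  qed
  have "(\<Oplus>\<^bsub>mod_b M\<^esub>i\<in>{..Polynomial.degree q}. poly.coeff q i \<odot>\<^bsub>mod_b M\<^esub> (induced_mod_b M T ^^ i) (N +> x)) =
      N +> (\<Oplus>i\<in>{..Polynomial.degree q}. fps_const (poly.coeff q i) \<odot>\<^bsub>M\<^esub> (T ^^ i) x)" if "x \<in> carrier M" for x
    using that by (simp add: ind_pow ind_c Tpow ind_sum Pi_iff)
  moreover have "N +> y = N \<longleftrightarrow> y \<in> N" if "y \<in> carrier M" for y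
    using N.a_rcos_const[of y] N.a_rcos_self[OF that] by blast
  moreover have "(\<Oplus>i\<in>{..Polynomial.degree q}. fps_const (poly.coeff q i) \<odot>\<^bsub>M\<^esub> (T ^^ i) x) \<in> carrier M"
    if "x \<in> carrier M" for x
    using that Tpow by (intro M.finsum_closed) auto
  ultimately have "(\<Oplus>\<^bsub>mod_b M\<^esub>i\<in>{..Polynomial.degree q}. poly.coeff q i \<odot>\<^bsub>mod_b M\<^esub> (induced_mod_b M T ^^ i) (N +> x)) = N
      \<longleftrightarrow> (\<Oplus>i\<in>{..Polynomial.degree q}. fps_const (poly.coeff q i) \<odot>\<^bsub>M\<^esub> (T ^^ i) x) \<in> N" if "x \<in> carrier M" for x
    using that by simp
  note key = this
  show ?thesis
    unfolding annihilates_def N_def[symmetric] Q_simps(2)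
  proof (intro iffI ballI)
    fix x assume x: "x \<in> carrier M" and *: "\<forall>v\<in>carrier (mod_b M).
      (\<Oplus>\<^bsub>mod_b M\<^esub>i\<in>{..Polynomial.degree q}. poly.coeff q i \<odot>\<^bsub>mod_b M\<^esub> (induced_mod_b M T ^^ i) v) = N"
    show "(\<Oplus>i\<in>{..Polynomial.degree q}. fps_const (poly.coeff q i) \<odot>\<^bsub>M\<^esub> (T ^^ i) x) \<in> N"
      using bspec[OF * coset[OF x]] unfolding key[OF x] .
  next
    fix v assume *: "v \<in> carrier (mod_b M)" "\<forall>x\<in>carrier M.
      (\<Oplus>i\<in>{..Polynomial.degree q}. fps_const (poly.coeff q i) \<odot>\<^bsub>M\<^esub> (T ^^ i) x) \<in> N"
    obtain x where x: "x \<in> carrier M" "v = N +> x" using coset_E[OF *(1)] by (elim bexE)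
    show "(\<Oplus>\<^bsub>mod_b M\<^esub>i\<in>{..Polynomial.degree q}. poly.coeff q i \<odot>\<^bsub>mod_b M\<^esub> (induced_mod_b M T ^^ i) v) = N"
      using bspec[OF *(2) x(1)] unfolding x(2) key[OF x(1)] .
  qed
qed

end

section \<open>Simple poles\<close>

text \<open>Meant for E, E[b^-1] and their simple pole submodules. The Leibniz rule for all series
  is part of the locale: the commutation rule gives it only for polynomials, and the passage to
  series in E rests on the b-adic separation of E, which is lost in E[b^-1].\<close>

locale torsion_free_ab = Cb_module M for M :: "('e, 'm) ab_struct_scheme" (structure) +
  assumes a_closed [simp]: "x \<in> carrier M \<Longrightarrow> aop M x \<in> carrier M"
    and a_add: "x \<in> carrier M \<Longrightarrow> y \<in> carrier M \<Longrightarrow> aop M (x \<oplus> y) = aop M x \<oplus> aop M y"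
    and a_leibniz: "x \<in> carrier M \<Longrightarrow>
      aop M (f \<odot>\<^bsub>M\<^esub> x) = f \<odot>\<^bsub>M\<^esub> aop M x \<oplus> (fps_X\<^sup>2 * fps_deriv f) \<odot>\<^bsub>M\<^esub> x"
    and X_inj: "x \<in> carrier M \<Longrightarrow> y \<in> carrier M \<Longrightarrow> fps_X \<odot>\<^bsub>M\<^esub> x = fps_X \<odot>\<^bsub>M\<^esub> y \<Longrightarrow> x = y"
begin

lemma X_power_inj:
  assumes "x \<in> carrier M" "y \<in> carrier M" "fps_X ^ n \<odot>\<^bsub>M\<^esub> x = fps_X ^ n \<odot>\<^bsub>M\<^esub> y"
  shows "x = y"
  using assms(3)
proof (induction n)
  case 0
  then show ?case using assms(1,2) by simp
next
  case (Suc n)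
  then have "fps_X \<odot>\<^bsub>M\<^esub> (fps_X ^ n \<odot>\<^bsub>M\<^esub> x) = fps_X \<odot>\<^bsub>M\<^esub> (fps_X ^ n \<odot>\<^bsub>M\<^esub> y)"
    using assms(1,2) by (simp add: sm_assoc)
  from X_inj[OF _ _ this] show ?case using assms(1,2) by (intro Suc.IH) simp
qed

end

locale simple_pole_module = torsion_free_ab M for M :: "('e, 'm) ab_struct_scheme" (structure) +
  assumes pole: "x \<in> carrier M \<Longrightarrow> \<exists>y\<in>carrier M. fps_X \<odot>\<^bsub>M\<^esub> y = aop M x"
begin

lemma binva_eqI:
  assumes "y \<in> carrier M" "fps_X \<odot>\<^bsub>M\<^esub> y = aop M x"
  shows "binva M x = y"
  unfolding binva_def bop_def by (rule the_equality) (use assms X_inj in auto)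

lemma X_binva: "x \<in> carrier M \<Longrightarrow> fps_X \<odot>\<^bsub>M\<^esub> binva M x = aop M x"
  and binva_closed [simp]: "x \<in> carrier M \<Longrightarrow> binva M x \<in> carrier M"
  using pole[of x] binva_eqI[of _ x] by auto

lemma binva_add:
  assumes "x \<in> carrier M" "y \<in> carrier M"
  shows "binva M (x \<oplus> y) = binva M x \<oplus> binva M y"
  by (rule binva_eqI) (use assms in \<open>simp_all add: sm_add_r X_binva a_add\<close>)

text \<open>The error term is a multiple of \<open>b\<close>: \<open>b^-1 a\<close> is not linear
  over C[[b]] but becomes so modulo \<open>b\<close>.\<close>

lemma binva_leibniz:
  assumes "x \<in> carrier M"
  shows "binva M (f \<odot>\<^bsub>M\<^esub> x) = f \<odot>\<^bsub>M\<^esub> binva M x \<oplus> (fps_X * fps_deriv f) \<odot>\<^bsub>M\<^esub> x"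
proof (rule binva_eqI)
  have "fps_X \<odot>\<^bsub>M\<^esub> (f \<odot>\<^bsub>M\<^esub> binva M x) = f \<odot>\<^bsub>M\<^esub> (fps_X \<odot>\<^bsub>M\<^esub> binva M x)"
    using assms by (simp add: sm_assoc mult.commute)
  then show "fps_X \<odot>\<^bsub>M\<^esub> (f \<odot>\<^bsub>M\<^esub> binva M x \<oplus> (fps_X * fps_deriv f) \<odot>\<^bsub>M\<^esub> x) = aop M (f \<odot>\<^bsub>M\<^esub> x)"
    using assms by (simp add: sm_add_r sm_assoc X_binva a_leibniz power2_eq_square mult.assoc)
qed (use assms in simp)

definition minus_binva :: "'e \<Rightarrow> 'e"
  where "minus_binva x = \<ominus> binva M x"

lemma minus_binva_closed [simp]: "x \<in> carrier M \<Longrightarrow> minus_binva x \<in> carrier M"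
  by (simp add: minus_binva_def)

lemma minus_binva_pow_closed [simp]: "x \<in> carrier M \<Longrightarrow> (minus_binva ^^ i) x \<in> carrier M"
  by (induction i) simp_all

lemma minus_binva_add:
  assumes "x \<in> carrier M" "y \<in> carrier M"
  shows "minus_binva (x \<oplus> y) = minus_binva x \<oplus> minus_binva y"
  unfolding minus_binva_def binva_add[OF assms]
  by (rule M.minus_add) (use assms in simp_all)

lemma annihilates_residue:
  "annihilates (mod_b M) (induced_mod_b M minus_binva) q \<longleftrightarrow>
    (\<forall>x\<in>carrier M. (\<Oplus>i\<in>{..Polynomial.degree q}. fps_const (poly.coeff q i) \<odot>\<^bsub>M\<^esub> (minus_binva ^^ i) x) \<in> bop M ` carrier M)"
proof (rule annihilates_mod_b)
  fix x assume x: "x \<in> carrier M"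
  have "minus_binva (fps_X \<odot>\<^bsub>M\<^esub> x) = fps_X \<odot>\<^bsub>M\<^esub> (\<ominus> (binva M x \<oplus> x))"
    unfolding minus_binva_def using x by (simp add: binva_leibniz smult_r_minus sm_add_r)
  then show "minus_binva (fps_X \<odot>\<^bsub>M\<^esub> x) \<in> bop M ` carrier M"
    unfolding bM_iff by (rule bexI) (use x in simp)
qed (simp_all only: minus_binva_closed minus_binva_add)

end

section \<open>Modules in duality modulo b\<close>

text \<open>\<open>N\<close> becomes the biggest simple pole submodule and \<open>M\<close> the
  saturation. \<open>B\<close> depends only on classes modulo \<open>b\<close>, so the pairing of
  the quotients can be studied without handling cosets. Finite generation of \<open>N\<close>
  provides a nonzero annihilating polynomial, which the pairing transfers to
  \<open>M\<close>.\<close>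

locale mod_b_duality = N: simple_pole_module N + M: simple_pole_module M
  for N :: "('e, 'm) ab_struct_scheme" and M :: "('g, 'n) ab_struct_scheme" +
  fixes B :: "'e \<Rightarrow> 'g \<Rightarrow> complex" and \<delta> :: complex
  assumes B_add_left: "\<lbrakk>x \<in> carrier N; x' \<in> carrier N; y \<in> carrier M\<rbrakk> \<Longrightarrow>
      B (x \<oplus>\<^bsub>N\<^esub> x') y = B x y + B x' y"
    and B_add_right: "\<lbrakk>x \<in> carrier N; y \<in> carrier M; y' \<in> carrier M\<rbrakk> \<Longrightarrow>
      B x (y \<oplus>\<^bsub>M\<^esub> y') = B x y + B x y'"
    and B_smult_left: "\<lbrakk>x \<in> carrier N; y \<in> carrier M\<rbrakk> \<Longrightarrow> B (f \<odot>\<^bsub>N\<^esub> x) y = f $ 0 * B x y"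
    and B_smult_right: "\<lbrakk>x \<in> carrier N; y \<in> carrier M\<rbrakk> \<Longrightarrow> B x (f \<odot>\<^bsub>M\<^esub> y) = f $ 0 * B x y"
    and B_binva: "\<lbrakk>x \<in> carrier N; y \<in> carrier M\<rbrakk> \<Longrightarrow>
      B (binva N x) y + B x (binva M y) = \<delta> * B x y"
    and nondegenerate_left: "\<lbrakk>x \<in> carrier N; \<And>y. y \<in> carrier M \<Longrightarrow> B x y = 0\<rbrakk> \<Longrightarrow>
      \<exists>x'\<in>carrier N. x = fps_X \<odot>\<^bsub>N\<^esub> x'"
    and nondegenerate_right: "\<lbrakk>y \<in> carrier M; \<And>x. x \<in> carrier N \<Longrightarrow> B x y = 0\<rbrakk> \<Longrightarrow>
      \<exists>y'\<in>carrier M. y = fps_X \<odot>\<^bsub>M\<^esub> y'"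
    and finitely_generated: "\<exists>I s c. finite (I :: nat set) \<and> N.dual_system I (carrier N) s c"
begin

abbreviation S where "S \<equiv> N.minus_binva"
abbreviation T where "T \<equiv> M.minus_binva"
abbreviation refl_poly where "refl_poly \<equiv> [:- \<delta>, - 1:]"

lemma bN_iff:
  assumes "x \<in> carrier N"
  shows "x \<in> bop N ` carrier N \<longleftrightarrow> (\<forall>y\<in>carrier M. B x y = 0)"
  unfolding N.bM_iff using nondegenerate_left[OF assms] by (auto simp: B_smult_left)

lemma bM_iff:
  assumes "y \<in> carrier M"
  shows "y \<in> bop M ` carrier M \<longleftrightarrow> (\<forall>x\<in>carrier N. B x y = 0)"
  unfolding M.bM_iff using nondegenerate_right[OF assms] by (auto simp: B_smult_right)

lemma B_finsum_left:
  assumes "finite A" "g \<in> A \<rightarrow> carrier N" "y \<in> carrier M"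
  shows "B (\<Oplus>\<^bsub>N\<^esub>i\<in>A. g i) y = (\<Sum>i\<in>A. B (g i) y)"
  using assms B_smult_left[of "\<zero>\<^bsub>N\<^esub>" y 0]
  by (intro N.additive_finsum[where B = "\<lambda>x. B x y"]) (simp_all add: B_add_left)

lemma B_finsum_right:
  assumes "finite A" "g \<in> A \<rightarrow> carrier M" "x \<in> carrier N"
  shows "B x (\<Oplus>\<^bsub>M\<^esub>i\<in>A. g i) = (\<Sum>i\<in>A. B x (g i))"
  using assms B_smult_right[of x "\<zero>\<^bsub>M\<^esub>" 0]
  by (intro M.additive_finsum[where B = "B x"]) (simp_all add: B_add_right)

text \<open>Since the left kernel of \<open>B\<close> is \<open>bN\<close>, the vanishing of
  \<open>q(S)\<close> modulo \<open>b\<close> is visible in the number sequences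
  \<open>B ((S ^^ i) x) y\<close>.\<close>

lemma annihilates_N:
  "annihilates (mod_b N) (induced_mod_b N S) q \<longleftrightarrow>
    (\<forall>x\<in>carrier N. \<forall>y\<in>carrier M. plin (\<lambda>i. B ((S ^^ i) x) y) q = 0)"
proof -
  have "(\<Oplus>\<^bsub>N\<^esub>i\<in>{..degree q}. fps_const (coeff q i) \<odot>\<^bsub>N\<^esub> (S ^^ i) x) \<in> bop N ` carrier N \<longleftrightarrow>
      (\<forall>y\<in>carrier M. plin (\<lambda>i. B ((S ^^ i) x) y) q = 0)" if x: "x \<in> carrier N" for x
  proof -
    have "(\<Oplus>\<^bsub>N\<^esub>i\<in>{..degree q}. fps_const (coeff q i) \<odot>\<^bsub>N\<^esub> (S ^^ i) x) \<in> carrier N"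
      using x by (intro N.M.finsum_closed) auto
    note bN_iff[OF this]
    moreover have "B (\<Oplus>\<^bsub>N\<^esub>i\<in>{..degree q}. fps_const (coeff q i) \<odot>\<^bsub>N\<^esub> (S ^^ i) x) y =
        plin (\<lambda>i. B ((S ^^ i) x) y) q" if "y \<in> carrier M" for y
      using x that by (subst B_finsum_left) (simp_all add: B_smult_left plin_def)
    ultimately show ?thesis by simp
  qed
  then show ?thesis unfolding N.annihilates_residue by simp
qed

lemma annihilates_M:
  "annihilates (mod_b M) (induced_mod_b M T) q \<longleftrightarrow>
    (\<forall>x\<in>carrier N. \<forall>y\<in>carrier M. plin (\<lambda>i. B x ((T ^^ i) y)) q = 0)"
proof -
  have "(\<Oplus>\<^bsub>M\<^esub>i\<in>{..degree q}. fps_const (coeff q i) \<odot>\<^bsub>M\<^esub> (T ^^ i) y) \<in> bop M ` carrier M \<longleftrightarrow>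
      (\<forall>x\<in>carrier N. plin (\<lambda>i. B x ((T ^^ i) y)) q = 0)" if y: "y \<in> carrier M" for y
  proof -
    have "(\<Oplus>\<^bsub>M\<^esub>i\<in>{..degree q}. fps_const (coeff q i) \<odot>\<^bsub>M\<^esub> (T ^^ i) y) \<in> carrier M"
      using y by (intro M.M.finsum_closed) auto
    note bM_iff[OF this]
    moreover have "B x (\<Oplus>\<^bsub>M\<^esub>i\<in>{..degree q}. fps_const (coeff q i) \<odot>\<^bsub>M\<^esub> (T ^^ i) y) =
        plin (\<lambda>i. B x ((T ^^ i) y)) q" if "x \<in> carrier N" for x
      using y that by (subst B_finsum_right) (simp_all add: B_smult_right plin_def)
    ultimately show ?thesis by simp
  qed
  then show ?thesis unfolding M.annihilates_residue by (intro iffI ballI) simp_all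
qed

lemma B_S:
  assumes "x \<in> carrier N" "y \<in> carrier M"
  shows "B (S x) y = - \<delta> * B x y - B x (T y)"
proof -
  have "B (S x) y = - B (binva N x) y" "B x (T y) = - B x (binva M y)"
    unfolding N.minus_binva_def M.minus_binva_def using assms
    by (simp_all add: N.sm_neg_one M.sm_neg_one B_smult_left B_smult_right)
  then show ?thesis using B_binva[OF assms] by (simp add: algebra_simps)
qed

text \<open>Adjointness passes from \<open>S\<close> to \<open>q(S)\<close> by Horner's scheme:
  peeling off one coefficient replaces \<open>x\<close> by \<open>S x\<close>, hence the arbitrary
  \<open>x\<close> in the induction, and \<open>B_S\<close> moves that single \<open>S\<close>
  across.\<close>

lemma plin_reflect:
  assumes "x \<in> carrier N" "y \<in> carrier M"
  shows "plin (\<lambda>i. B ((S ^^ i) x) y) q = plin (\<lambda>i. B x ((T ^^ i) y)) (pcompose q refl_poly)"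
  using assms(1)
proof (induction q arbitrary: x)
  case 0
  then show ?case by simp
next
  case (pCons c q)
  let ?q = "pcompose q refl_poly"
  have "plin (\<lambda>i. B ((S ^^ i) x) y) (pCons c q) = c * B x y + plin (\<lambda>i. B ((S ^^ i) (S x)) y) q"
    by (simp add: plin_pCons funpow_swap1)
  also have "plin (\<lambda>i. B ((S ^^ i) (S x)) y) q = plin (\<lambda>i. B (S x) ((T ^^ i) y)) ?q"
    using pCons by simp
  also have "\<dots> = plin (\<lambda>i. - \<delta> * B x ((T ^^ i) y) + (- 1) * B x ((T ^^ Suc i) y)) ?q"
    using assms pCons.prems by (simp add: B_S)
  also have "c * B x y + \<dots> = plin (\<lambda>i. B x ((T ^^ i) y)) (pcompose (pCons c q) refl_poly)"
  proof -
    have "pcompose (pCons c q) refl_poly =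
        pCons c 0 + (Polynomial.smult (- \<delta>) ?q + pCons 0 (Polynomial.smult (- 1) ?q))"
      by (simp add: pcompose_pCons)
    then show ?thesis
      unfolding plin_add_left plin_smult_left
      by (simp only: plin_add plin_smult plin_pCons plin_0 funpow.simps id_apply comp_apply) simp
  qed
  finally show ?case .
qed

lemma reflect_reflect: "pcompose (pcompose q refl_poly) refl_poly = q"
proof -
  have "pcompose refl_poly refl_poly = [:0, 1:]"
    by (simp add: pcompose_pCons)
  then show ?thesis
    by (simp add: pcompose_assoc[symmetric] pcompose_idR)
qed

text \<open>For each generator \<open>s j\<close>, the constant terms of the coordinates of the
  iterates of \<open>S\<close> at \<open>s j\<close> form finitely many sequences, and a polynomial
  killing all of them annihilates \<open>s j\<close> modulo \<open>b\<close>. The product over the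
  generators annihilates everything.\<close>

lemma ex_annihilator: "\<exists>q. q \<noteq> 0 \<and> annihilates (mod_b N) (induced_mod_b N S) q"
proof -
  obtain I :: "nat set" and s c where I: "finite I" and sc: "N.dual_system I (carrier N) s c"
    using finitely_generated by blast
  note s = N.dual_systemD(1)[OF sc] and gen = N.dual_systemD(4)[OF sc]
  have B_gen: "B x y = (\<Sum>i\<in>I. (c i x $ 0) * B (s i) y)" if "x \<in> carrier N" "y \<in> carrier M" for x y
  proof -
    have "B x y = B (\<Oplus>\<^bsub>N\<^esub>i\<in>I. c i x \<odot>\<^bsub>N\<^esub> s i) y"
      by (simp only: gen[OF that(1)])
    also have "\<dots> = (\<Sum>i\<in>I. (c i x $ 0) * B (s i) y)"
      using I s that by (subst B_finsum_left) (auto simp: B_smult_left)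
    finally show ?thesis .
  qed
  define K where "K x = {q. \<forall>y\<in>carrier M. plin (\<lambda>i. B ((S ^^ i) x) y) q = 0}" for x
  have K_mult: "p * q \<in> K x" if x: "x \<in> carrier N" and q: "q \<in> K x" for p q x
  proof (induction p)
    case 0
    show ?case by (simp add: K_def)
  next
    case (pCons a p)
    have "plin (\<lambda>i. B ((S ^^ i) x) y) (pCons 0 (p * q)) = 0" if y: "y \<in> carrier M" for y
    proof -
      \<comment> \<open>Multiplication by the variable applies one more \<open>S\<close>;
        \<open>B_S\<close> trades it for \<open>T y\<close>, and membership in \<open>K x\<close>
        covers every \<open>y\<close>.\<close>
      have "plin (\<lambda>i. B ((S ^^ i) x) y) (pCons 0 (p * q)) =
          plin (\<lambda>i. - \<delta> * B ((S ^^ i) x) y + (- 1) * B ((S ^^ i) x) (T y)) (p * q)"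
        using x y by (simp add: plin_pCons B_S)
      also have "\<dots> = 0"
        unfolding plin_add_left plin_smult_left using pCons(2) y by (simp add: K_def)
      finally show ?thesis .
    qed
    then show ?case
      using q by (simp add: K_def plin_add plin_smult)
  qed
  have "\<exists>q. q \<noteq> 0 \<and> q \<in> K (s j)" if j: "j \<in> I" for j
  proof -
    obtain q where q: "q \<noteq> 0" "\<forall>i\<in>I. plin (\<lambda>k. c i ((S ^^ k) (s j)) $ 0) q = 0"
      using plin_common_kernel[OF I, of 0 "\<lambda>i k. c i ((S ^^ k) (s j)) $ 0"] by blast
    have "plin (\<lambda>k. B ((S ^^ k) (s j)) y) q = 0" if "y \<in> carrier M" for y
    proof -
      have "plin (\<lambda>k. B ((S ^^ k) (s j)) y) q =
          plin (\<lambda>k. \<Sum>i\<in>I. B (s i) y * (c i ((S ^^ k) (s j)) $ 0)) q"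
        using B_gen[OF N.minus_binva_pow_closed[OF s[OF j]] that] by (simp add: mult.commute)
      also have "\<dots> = 0"
        unfolding plin_sum_left plin_smult_left using q(2) by simp
      finally show ?thesis .
    qed
    then show ?thesis using q(1) by (auto simp: K_def)
  qed
  then obtain q where q: "\<And>j. j \<in> I \<Longrightarrow> q j \<noteq> 0" "\<And>j. j \<in> I \<Longrightarrow> q j \<in> K (s j)"
    by metis
  define Q where "Q = (\<Prod>j\<in>I. q j)"
  have QK: "Q \<in> K (s j)" if "j \<in> I" for j
    using K_mult[OF s[OF that] q(2)[OF that], of "prod q (I - {j})"] that I
    by (simp add: Q_def prod.remove mult.commute)
  have "plin (\<lambda>i. B ((S ^^ i) x) y) Q = 0" if xy: "x \<in> carrier N" "y \<in> carrier M" for x y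
  proof -
    \<comment> \<open>The operator is moved to \<open>y\<close>, so that \<open>x\<close> stands
      alone and can be expanded in the generators; it is then moved back to each
      \<open>s j\<close>.\<close>
    have "plin (\<lambda>i. B ((S ^^ i) x) y) Q = plin (\<lambda>i. B x ((T ^^ i) y)) (pcompose Q refl_poly)"
      using xy by (rule plin_reflect)
    also have "\<dots> = plin (\<lambda>i. \<Sum>j\<in>I. (c j x $ 0) * B (s j) ((T ^^ i) y)) (pcompose Q refl_poly)"
      using B_gen[OF xy(1) M.minus_binva_pow_closed[OF xy(2)]] by simp
    also have "\<dots> = (\<Sum>j\<in>I. (c j x $ 0) * plin (\<lambda>i. B ((S ^^ i) (s j)) y) Q)"
      unfolding plin_sum_left plin_smult_left using xy s by (simp add: plin_reflect)
    also have "\<dots> = 0" using QK xy by (simp add: K_def)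
    finally show ?thesis .
  qed
  moreover have "Q \<noteq> 0" using q(1) I by (simp add: Q_def)
  ultimately show ?thesis unfolding annihilates_N by (intro exI[of _ Q]) simp
qed

text \<open>The annihilators on the side of \<open>M\<close> are the image of those on the side of
  \<open>N\<close> under z |-> -\<delta> - z. This substitution is an involution that preserves
  divisibility, so it carries a generator to a generator, and a single appeal to
  \<open>ex_annihilator\<close> serves both sides.\<close>

theorem residue_poly_reflect:
  "residue_poly N = Polynomial.smult ((- 1) ^ degree (residue_poly M)) (pcompose (residue_poly M) refl_poly)"
proof -
  define J where "J = {q. annihilates (mod_b N) (induced_mod_b N S) q}"
  have J_iff: "q \<in> J \<longleftrightarrow> (\<forall>x\<in>carrier N. \<forall>y\<in>carrier M. plin (\<lambda>i. B ((S ^^ i) x) y) q = 0)" for q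
    unfolding J_def annihilates_N by simp
  have "p * q \<in> J" if q: "q \<in> J" for p q
  proof (induction p)
    case 0
    show ?case by (simp add: J_iff)
  next
    case (pCons a p)
    have "plin (\<lambda>i. B ((S ^^ i) x) y) (pCons 0 (p * q)) = 0" if "x \<in> carrier N" "y \<in> carrier M" for x y
      using pCons(2) that unfolding J_iff plin_pCons by (simp add: funpow_swap1)
    then show ?case
      using q by (simp add: J_iff plin_add plin_smult)
  qed
  moreover have "p + q \<in> J" if "p \<in> J" "q \<in> J" for p q
    using that by (simp add: J_iff plin_add)
  moreover have "\<exists>q\<in>J. q \<noteq> 0"
    using ex_annihilator unfolding J_def by auto
  ultimately obtain p where p: "lead_coeff p = 1" "\<And>q. q \<in> J \<longleftrightarrow> p dvd q"
    using poly_ideal_generator[of J] by blast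
  have sign: "(- 1) ^ n * (- 1) ^ n = (1 :: complex)" for n
    by (simp flip: power_mult_distrib)
  have N: "residue_poly N = p"
    unfolding residue_poly_def N.minus_binva_def[symmetric]
    by (rule minimal_poly_eqI) (use p in \<open>simp_all add: J_def\<close>)
  \<comment> \<open>The sign makes \<open>p'\<close> monic; as its square is 1, the relation between
    \<open>p\<close> and \<open>p'\<close> is symmetric.\<close>
  define p' where "p' = Polynomial.smult ((- 1) ^ degree p) (pcompose p refl_poly)"
  have "annihilates (mod_b M) (induced_mod_b M T) q \<longleftrightarrow> p' dvd q" for q
  proof -
    have "annihilates (mod_b M) (induced_mod_b M T) q \<longleftrightarrow> pcompose q refl_poly \<in> J"
      unfolding annihilates_M J_iff by (simp add: plin_reflect reflect_reflect)
    also have "\<dots> \<longleftrightarrow> pcompose p refl_poly dvd q"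
      unfolding p(2)
    proof
      assume "p dvd pcompose q refl_poly"
      then obtain k where "pcompose q refl_poly = p * k" by (elim dvdE)
      then have "pcompose (pcompose q refl_poly) refl_poly = pcompose p refl_poly * pcompose k refl_poly"
        by (simp only: pcompose_mult)
      then show "pcompose p refl_poly dvd q" unfolding reflect_reflect by simp
    next
      assume "pcompose p refl_poly dvd q"
      then obtain k where "q = pcompose p refl_poly * k" by (elim dvdE)
      then have "pcompose q refl_poly = p * pcompose k refl_poly"
        by (simp only: pcompose_mult reflect_reflect)
      then show "p dvd pcompose q refl_poly" by simp
    qed
    also have "\<dots> \<longleftrightarrow> p' dvd q" by (simp add: p'_def smult_dvd_iff)
    finally show ?thesis .
  qed
  moreover have "lead_coeff p' = 1"
    using p(1) unfolding p'_def lead_coeff_smult lead_coeff_pcompose_reflect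
    by (simp only: sign mult_1_left)
  ultimately have M: "residue_poly M = p'"
    unfolding residue_poly_def M.minus_binva_def[symmetric] by (intro minimal_poly_eqI)
  have "degree p' = degree p" by (simp add: p'_def degree_pcompose)
  moreover have "pcompose p' refl_poly = Polynomial.smult ((- 1) ^ degree p) p"
    unfolding p'_def pcompose_smult reflect_reflect ..
  ultimately show ?thesis
    unfolding M N by (simp only: smult_smult sign power_one smult_1_left)
qed

end

text \<open>For the saturation inside E[b^-1] and the dual lattice inside E. Stability under
  \<open>a\<close> comes from \<open>a x = b y\<close> with \<open>y\<close> in
  \<open>H\<close>.\<close>

lemma (in torsion_free_ab) simple_pole_submodule:
  assumes H: "submodule H Cb M" and pole: "\<And>x. x \<in> H \<Longrightarrow> \<exists>y\<in>H. fps_X \<odot>\<^bsub>M\<^esub> y = aop M x"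
  shows "simple_pole_module (M\<lparr>carrier := H\<rparr>)"
proof -
  have HM: "x \<in> carrier M" if "x \<in> H" for x
    using that H submodule_iff by auto
  have "module Cb (M\<lparr>carrier := H\<rparr>)"
    by (rule submodule.submodule_is_module[OF H]) (rule module_axioms)
  then interpret H: Cb_module "M\<lparr>carrier := H\<rparr>"
    by (rule Cb_module.intro)
  show ?thesis
  proof (intro simple_pole_module.intro torsion_free_ab.intro torsion_free_ab_axioms.intro
      simple_pole_module_axioms.intro)
    show "Cb_module (M\<lparr>carrier := H\<rparr>)" by (rule H.Cb_module_axioms)
  next
    fix x assume x: "x \<in> carrier (M\<lparr>carrier := H\<rparr>)"
    obtain y where y: "y \<in> H" "fps_X \<odot>\<^bsub>M\<^esub> y = aop M x"
      using pole x by auto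
    then show "\<exists>y\<in>carrier (M\<lparr>carrier := H\<rparr>). fps_X \<odot>\<^bsub>M\<lparr>carrier := H\<rparr>\<^esub> y = aop (M\<lparr>carrier := H\<rparr>) x"
      by auto
    show "aop (M\<lparr>carrier := H\<rparr>) x \<in> carrier (M\<lparr>carrier := H\<rparr>)"
      using y H submodule_iff by (auto simp flip: y(2))
    show "aop (M\<lparr>carrier := H\<rparr>) (f \<odot>\<^bsub>M\<lparr>carrier := H\<rparr>\<^esub> x) = f \<odot>\<^bsub>M\<lparr>carrier := H\<rparr>\<^esub> aop (M\<lparr>carrier := H\<rparr>) x
        \<oplus>\<^bsub>M\<lparr>carrier := H\<rparr>\<^esub> (fps_X\<^sup>2 * fps_deriv f) \<odot>\<^bsub>M\<lparr>carrier := H\<rparr>\<^esub> x" for f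
      using a_leibniz HM x by simp
  next
    fix x y assume "x \<in> carrier (M\<lparr>carrier := H\<rparr>)" "y \<in> carrier (M\<lparr>carrier := H\<rparr>)"
    then have xy: "x \<in> carrier M" "y \<in> carrier M" using HM by simp_all
    show "aop (M\<lparr>carrier := H\<rparr>) (x \<oplus>\<^bsub>M\<lparr>carrier := H\<rparr>\<^esub> y) =
        aop (M\<lparr>carrier := H\<rparr>) x \<oplus>\<^bsub>M\<lparr>carrier := H\<rparr>\<^esub> aop (M\<lparr>carrier := H\<rparr>) y"
      using a_add[OF xy] by simp
    assume "fps_X \<odot>\<^bsub>M\<lparr>carrier := H\<rparr>\<^esub> x = fps_X \<odot>\<^bsub>M\<lparr>carrier := H\<rparr>\<^esub> y"
    then show "x = y" using X_inj[OF xy] by simp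
  qed
qed

section \<open>Coordinates\<close>

sublocale ab_module \<subseteq> Cb_module M
  by unfold_locales

context ab_module
begin

text \<open>An injective linear map to a free module of finite rank, which turns identities in the
  module into identities of power series. Indices are numbers rather than basis elements so that the
  coordinates of one module can be pulled back to another, as happens for the saturation.\<close>

definition coordinates :: "nat set \<Rightarrow> (nat \<Rightarrow> 'e \<Rightarrow> complex fps) \<Rightarrow> bool"
  where "coordinates I \<pi> \<longleftrightarrow> finite I \<and>
    (\<forall>i\<in>I. \<forall>x\<in>carrier M. \<forall>y\<in>carrier M. \<pi> i (x \<oplus> y) = \<pi> i x + \<pi> i y) \<and>
    (\<forall>i\<in>I. \<forall>x\<in>carrier M. \<forall>f. \<pi> i (f \<odot>\<^bsub>M\<^esub> x) = f * \<pi> i x) \<and>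
    (\<forall>x\<in>carrier M. (\<forall>i\<in>I. \<pi> i x = 0) \<longrightarrow> x = \<zero>)"

lemma ex_coordinates: "\<exists>I \<pi>. coordinates I \<pi>"
proof -
  obtain B where B: "finite B" "B \<subseteq> carrier M"
    and ex: "\<And>x. x \<in> carrier M \<Longrightarrow> \<exists>!c. c \<in> B \<rightarrow>\<^sub>E UNIV \<and> x = (\<Oplus>v\<in>B. c v \<odot>\<^bsub>M\<^esub> v)"
    using free unfolding free_finite_rank_def Cb_simps
    by (elim exE conjE) (rule that, assumption+, erule bspec)
  define c where "c x = (THE c. c \<in> B \<rightarrow>\<^sub>E UNIV \<and> x = (\<Oplus>v\<in>B. c v \<odot>\<^bsub>M\<^esub> v))" for x
  have c: "c x \<in> B \<rightarrow>\<^sub>E UNIV" "x = (\<Oplus>v\<in>B. c x v \<odot>\<^bsub>M\<^esub> v)" if "x \<in> carrier M" for x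
    using theI'[OF ex[OF that]] unfolding c_def by blast+
  have c_eqI: "c x v = d v" if "x \<in> carrier M" "x = (\<Oplus>v\<in>B. d v \<odot>\<^bsub>M\<^esub> v)" "v \<in> B" for x d v
  proof -
    have "(\<Oplus>v\<in>B. d v \<odot>\<^bsub>M\<^esub> v) = (\<Oplus>v\<in>B. restrict d B v \<odot>\<^bsub>M\<^esub> v)"
      by (rule M.finsum_cong') (use B in auto)
    then have "restrict d B \<in> B \<rightarrow>\<^sub>E UNIV \<and> x = (\<Oplus>v\<in>B. restrict d B v \<odot>\<^bsub>M\<^esub> v)"
      using that(2) by auto
    then have "c x = restrict d B"
      using the1_equality[OF ex[OF that(1)]] unfolding c_def by blast
    then show ?thesis using that(3) by simp
  qed
  have add: "c (x \<oplus> y) v = c x v + c y v" if xy: "x \<in> carrier M" "y \<in> carrier M" and v: "v \<in> B" for x y v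
  proof (rule c_eqI[OF _ _ v])
    have "(\<Oplus>v\<in>B. (c x v + c y v) \<odot>\<^bsub>M\<^esub> v) = (\<Oplus>v\<in>B. c x v \<odot>\<^bsub>M\<^esub> v \<oplus> c y v \<odot>\<^bsub>M\<^esub> v)"
      by (rule M.finsum_cong') (use B in \<open>auto simp: sm_add\<close>)
    also have "\<dots> = (\<Oplus>v\<in>B. c x v \<odot>\<^bsub>M\<^esub> v) \<oplus> (\<Oplus>v\<in>B. c y v \<odot>\<^bsub>M\<^esub> v)"
      by (rule M.finsum_addf) (use B in auto)
    also have "\<dots> = x \<oplus> y" by (simp only: c(2)[OF xy(1), symmetric] c(2)[OF xy(2), symmetric])
    finally show "x \<oplus> y = (\<Oplus>v\<in>B. (c x v + c y v) \<odot>\<^bsub>M\<^esub> v)" by (rule sym)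
  qed (use xy in simp)
  have scale: "c (f \<odot>\<^bsub>M\<^esub> x) v = f * c x v" if x: "x \<in> carrier M" and v: "v \<in> B" for f x v
  proof (rule c_eqI[OF _ _ v])
    have "f \<odot>\<^bsub>M\<^esub> x = f \<odot>\<^bsub>M\<^esub> (\<Oplus>v\<in>B. c x v \<odot>\<^bsub>M\<^esub> v)" by (simp only: c(2)[OF x, symmetric])
    also have "\<dots> = (\<Oplus>v\<in>B. f \<odot>\<^bsub>M\<^esub> (c x v \<odot>\<^bsub>M\<^esub> v))"
      by (rule finsum_smult_ldistr) (use B in auto)
    also have "\<dots> = (\<Oplus>v\<in>B. (f * c x v) \<odot>\<^bsub>M\<^esub> v)"
      by (rule M.finsum_cong') (use B in \<open>auto simp: sm_assoc\<close>)
    finally show "f \<odot>\<^bsub>M\<^esub> x = (\<Oplus>v\<in>B. (f * c x v) \<odot>\<^bsub>M\<^esub> v)" .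
  qed (use x in simp)
  have inj: "x = \<zero>" if x: "x \<in> carrier M" and 0: "\<And>v. v \<in> B \<Longrightarrow> c x v = 0" for x
  proof -
    have "(\<Oplus>v\<in>B. c x v \<odot>\<^bsub>M\<^esub> v) = (\<Oplus>v\<in>B. \<zero>)"
      by (rule M.finsum_cong') (use 0 B in auto)
    then show ?thesis using c(2)[OF x] by simp
  qed
  obtain h where h: "bij_betw h {0..<card B} B"
    using ex_bij_betw_nat_finite[OF B(1)] by blast
  have hB: "h i \<in> B" if "i \<in> {0..<card B}" for i
    using h that by (rule bij_betwE[THEN bspec])
  have "coordinates {0..<card B} (\<lambda>i x. c x (h i))"
    unfolding coordinates_def
  proof (intro conjI ballI allI impI)
    fix x assume x: "x \<in> carrier M" "\<forall>i\<in>{0..<card B}. c x (h i) = 0"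
    have "c x v = 0" if "v \<in> B" for v
    proof -
      have "v \<in> h ` {0..<card B}" using that bij_betw_imp_surj_on[OF h] by simp
      then show ?thesis using x(2) by (elim imageE) simp
    qed
    then show "x = \<zero>" using inj x(1) by simp
  qed (simp_all add: hB add scale del: atLeastLessThan_iff)
  then show ?thesis by blast
qed

text \<open>Chosen once for the whole locale, so that linearity of the coordinates can be a
  simplification rule.\<close>

definition coord_index :: "nat set"
  where "coord_index = (SOME I. \<exists>\<pi>. coordinates I \<pi>)"

definition coord :: "nat \<Rightarrow> 'e \<Rightarrow> complex fps"
  where "coord = (SOME \<pi>. coordinates coord_index \<pi>)"

lemma coordinates_coord: "coordinates coord_index coord"
proof -
  have "\<exists>\<pi>. coordinates coord_index \<pi>"
    unfolding coord_index_def using ex_coordinates by (rule someI_ex)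
  then show ?thesis unfolding coord_def by (rule someI_ex)
qed

lemma finite_coord_index [simp]: "finite coord_index"
  and coord_add [simp]: "i \<in> coord_index \<Longrightarrow> x \<in> carrier M \<Longrightarrow> y \<in> carrier M \<Longrightarrow>
    coord i (x \<oplus> y) = coord i x + coord i y"
  and coord_smult [simp]: "i \<in> coord_index \<Longrightarrow> x \<in> carrier M \<Longrightarrow> coord i (f \<odot>\<^bsub>M\<^esub> x) = f * coord i x"
  and coord_eq_0: "x \<in> carrier M \<Longrightarrow> (\<And>i. i \<in> coord_index \<Longrightarrow> coord i x = 0) \<Longrightarrow> x = \<zero>"
  using coordinates_coord unfolding coordinates_def by simp_all

lemma coord_zero [simp]: "i \<in> coord_index \<Longrightarrow> coord i \<zero> = 0"
  using coord_smult[of i \<zero> 0] by simp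

lemma coord_neg [simp]: "i \<in> coord_index \<Longrightarrow> x \<in> carrier M \<Longrightarrow> coord i (\<ominus> x) = - coord i x"
  by (simp add: sm_neg_one)

lemma coord_minus [simp]:
  "i \<in> coord_index \<Longrightarrow> x \<in> carrier M \<Longrightarrow> y \<in> carrier M \<Longrightarrow> coord i (x \<ominus> y) = coord i x - coord i y"
  by (simp add: a_minus_def)

lemma coord_eqI:
  assumes "x \<in> carrier M" "y \<in> carrier M" and eq: "\<And>i. i \<in> coord_index \<Longrightarrow> coord i x = coord i y"
  shows "x = y"
proof -
  have "x \<ominus> y = \<zero>"
    by (rule coord_eq_0) (use assms in simp_all)
  then have "\<ominus> (\<ominus> y) = x"
    unfolding a_minus_def using assms(1,2) by (intro M.minus_equality) simp_all
  then show ?thesis using assms(2) by simp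
qed

lemma aop_X:
  assumes "x \<in> carrier M"
  shows "aop M (fps_X \<odot>\<^bsub>M\<^esub> x) = fps_X \<odot>\<^bsub>M\<^esub> aop M x \<oplus> fps_X\<^sup>2 \<odot>\<^bsub>M\<^esub> x"
proof (rule coord_eqI)
  fix i assume i: "i \<in> coord_index"
  have "coord i (aop M (bop M x) \<ominus> bop M (aop M x)) = coord i (bop M (bop M x))"
    using aop_bop[OF assms] by simp
  then show "coord i (aop M (fps_X \<odot>\<^bsub>M\<^esub> x)) = coord i (fps_X \<odot>\<^bsub>M\<^esub> aop M x \<oplus> fps_X\<^sup>2 \<odot>\<^bsub>M\<^esub> x)"
    using i assms by (simp add: bop_def aop_closed algebra_simps power2_eq_square)
qed (use assms in \<open>simp_all add: aop_closed\<close>)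

text \<open>The defect of the Leibniz rule for \<open>f\<close> is \<open>b\<close> times the defect for the shifted series, so
  it is divisible by every power of \<open>b\<close>.\<close>

lemma aop_leibniz:
  assumes x: "x \<in> carrier M"
  shows "aop M (f \<odot>\<^bsub>M\<^esub> x) = f \<odot>\<^bsub>M\<^esub> aop M x \<oplus> (fps_X\<^sup>2 * fps_deriv f) \<odot>\<^bsub>M\<^esub> x"
proof (rule coord_eqI)
  fix i assume i: "i \<in> coord_index"
  define d where "d f = coord i (aop M (f \<odot>\<^bsub>M\<^esub> x)) - f * coord i (aop M x) - fps_X\<^sup>2 * fps_deriv f * coord i x" for f
  have step: "d f = fps_X * d (fps_shift 1 f)" for f
  proof -
    define g where "g = fps_shift 1 f"
    have f: "f = fps_const (f $ 0) + fps_X * g"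
      unfolding g_def by (rule fps_ext) (auto simp: fps_X_mult_nth)
    have "f \<odot>\<^bsub>M\<^esub> x = fps_const (f $ 0) \<odot>\<^bsub>M\<^esub> x \<oplus> fps_X \<odot>\<^bsub>M\<^esub> (g \<odot>\<^bsub>M\<^esub> x)"
      by (subst f) (use x in \<open>simp add: sm_add sm_assoc\<close>)
    then have "coord i (aop M (f \<odot>\<^bsub>M\<^esub> x)) =
        fps_const (f $ 0) * coord i (aop M x) + fps_X * coord i (aop M (g \<odot>\<^bsub>M\<^esub> x)) + fps_X\<^sup>2 * g * coord i x"
      using x i by (simp add: aop_add aop_scale aop_X aop_closed algebra_simps)
    moreover have "fps_deriv f = g + fps_X * fps_deriv g"
      by (subst f) (simp add: algebra_simps)
    moreover have "f * coord i (aop M x) = fps_const (f $ 0) * coord i (aop M x) + fps_X * g * coord i (aop M x)"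
      by (subst f) (simp add: algebra_simps)
    ultimately show ?thesis
      unfolding d_def g_def[symmetric] by (simp add: algebra_simps)
  qed
  have "d f $ n = 0" for n
  proof (induction n arbitrary: f)
    case 0
    show ?case by (subst step) simp
  next
    case (Suc n)
    show ?case by (subst step) (simp add: fps_X_mult_nth Suc)
  qed
  then have "d f = 0" by (intro fps_ext) simp
  then show "coord i (aop M (f \<odot>\<^bsub>M\<^esub> x)) = coord i (f \<odot>\<^bsub>M\<^esub> aop M x \<oplus> (fps_X\<^sup>2 * fps_deriv f) \<odot>\<^bsub>M\<^esub> x)"
    using x i by (simp add: d_def aop_closed algebra_simps)
qed (use x in \<open>simp_all add: aop_closed\<close>)

end

sublocale ab_module \<subseteq> torsion_free_ab M
proof (unfold_locales)
  fix x y assume xy: "x \<in> carrier M" "y \<in> carrier M" "fps_X \<odot>\<^bsub>M\<^esub> x = fps_X \<odot>\<^bsub>M\<^esub> y"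
  show "x = y"
  proof (rule coord_eqI[OF xy(1,2)])
    fix i assume "i \<in> coord_index"
    moreover have "coord i (fps_X \<odot>\<^bsub>M\<^esub> x) = coord i (fps_X \<odot>\<^bsub>M\<^esub> y)" using xy(3) by simp
    ultimately show "coord i x = coord i y" using xy(1,2) by simp
  qed
qed (simp_all add: aop_closed aop_add aop_leibniz)

section \<open>Localization\<close>

text \<open>Operations on fractions are unions over representatives; such a union is a single class
  once the choice of representative does not matter.\<close>

lemma UN_const_eq:
  assumes "z \<in> S" and "\<And>x n. (x, n) \<in> S \<Longrightarrow> F x n = c"
  shows "(\<Union>(x, n)\<in>S. F x n) = c"
proof -
  have "(\<Union>(x, n)\<in>S. F x n) = (\<Union>p\<in>S. c)"
    by (intro SUP_cong refl) (auto simp: assms(2))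
  then show ?thesis using assms(1) by auto
qed

context ab_module
begin

abbreviation L where "L \<equiv> localization M"
abbreviation frac where "frac \<equiv> loc_frac M"

lemma mem_frac: "(y, m) \<in> frac x n \<longleftrightarrow> y \<in> carrier M \<and> fps_X ^ m \<odot>\<^bsub>M\<^esub> x = fps_X ^ n \<odot>\<^bsub>M\<^esub> y"
  by (simp add: loc_frac_def)

lemma frac_self: "x \<in> carrier M \<Longrightarrow> (x, n) \<in> frac x n"
  by (simp add: mem_frac)

text \<open>Transitivity is the point: it cancels a power of \<open>b\<close>, hence uses that the
  module is torsion free.\<close>

lemma frac_eq_iff:
  assumes x: "x \<in> carrier M" and y: "y \<in> carrier M"
  shows "frac x n = frac y m \<longleftrightarrow> fps_X ^ m \<odot>\<^bsub>M\<^esub> x = fps_X ^ n \<odot>\<^bsub>M\<^esub> y"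
proof
  assume "frac x n = frac y m"
  then have "(y, m) \<in> frac x n" using frac_self[OF y, of m] by simp
  then show "fps_X ^ m \<odot>\<^bsub>M\<^esub> x = fps_X ^ n \<odot>\<^bsub>M\<^esub> y" by (simp add: mem_frac)
next
  assume eq: "fps_X ^ m \<odot>\<^bsub>M\<^esub> x = fps_X ^ n \<odot>\<^bsub>M\<^esub> y"
  \<comment> \<open>Stated for fresh \<open>u\<close> and \<open>v\<close> because each of the two
    inclusions uses it, with \<open>x\<close> and \<open>y\<close> exchanged.\<close>
  have cross: "fps_X ^ k \<odot>\<^bsub>M\<^esub> v = fps_X ^ m \<odot>\<^bsub>M\<^esub> z"
    if u: "u \<in> carrier M" and v: "v \<in> carrier M" and z: "z \<in> carrier M"
      and 1: "fps_X ^ m \<odot>\<^bsub>M\<^esub> u = fps_X ^ n \<odot>\<^bsub>M\<^esub> v" and 2: "fps_X ^ k \<odot>\<^bsub>M\<^esub> u = fps_X ^ n \<odot>\<^bsub>M\<^esub> z"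
    for u v z and m n k :: nat
  proof (rule X_power_inj[of _ _ n])
    have "fps_X ^ n \<odot>\<^bsub>M\<^esub> (fps_X ^ k \<odot>\<^bsub>M\<^esub> v) = fps_X ^ k \<odot>\<^bsub>M\<^esub> (fps_X ^ n \<odot>\<^bsub>M\<^esub> v)"
      using v by (simp add: sm_assoc mult.commute)
    also have "\<dots> = fps_X ^ m \<odot>\<^bsub>M\<^esub> (fps_X ^ k \<odot>\<^bsub>M\<^esub> u)"
      unfolding 1[symmetric] using u by (simp add: sm_assoc mult.commute)
    also have "\<dots> = fps_X ^ n \<odot>\<^bsub>M\<^esub> (fps_X ^ m \<odot>\<^bsub>M\<^esub> z)"
      unfolding 2 using z by (simp add: sm_assoc mult.commute)
    finally show "fps_X ^ n \<odot>\<^bsub>M\<^esub> (fps_X ^ k \<odot>\<^bsub>M\<^esub> v) = fps_X ^ n \<odot>\<^bsub>M\<^esub> (fps_X ^ m \<odot>\<^bsub>M\<^esub> z)" .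
  qed (use v z in simp_all)
  show "frac x n = frac y m"
  proof (rule Set.set_eqI)
    fix p :: "'e \<times> nat" obtain z k where p: "p = (z, k)" by (cases p)
    show "p \<in> frac x n \<longleftrightarrow> p \<in> frac y m"
      unfolding p mem_frac using cross[OF x y _ eq, of z k] cross[OF y x _ eq[symmetric], of z k]
      by auto
  qed
qed

lemma carrier_L: "carrier L = {frac x n |x n. x \<in> carrier M}"
  and zero_L: "\<zero>\<^bsub>L\<^esub> = frac \<zero> 0"
  by (simp_all add: localization_def)

lemma frac_carrier [simp]: "x \<in> carrier M \<Longrightarrow> frac x n \<in> carrier L"
  unfolding carrier_L by blast

lemma carrier_L_cases:
  assumes "y \<in> carrier L"
  obtains x n where "x \<in> carrier M" "y = frac x n"
  using assms unfolding carrier_L by blast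

lemma frac_add:
  assumes x: "x \<in> carrier M" and y: "y \<in> carrier M"
  shows "frac x n \<oplus>\<^bsub>L\<^esub> frac y m = frac (fps_X ^ m \<odot>\<^bsub>M\<^esub> x \<oplus> fps_X ^ n \<odot>\<^bsub>M\<^esub> y) (n + m)"
proof -
  have "frac (fps_X ^ m' \<odot>\<^bsub>M\<^esub> x' \<oplus> fps_X ^ n' \<odot>\<^bsub>M\<^esub> y') (n' + m') =
      frac (fps_X ^ m \<odot>\<^bsub>M\<^esub> x \<oplus> fps_X ^ n \<odot>\<^bsub>M\<^esub> y) (n + m)"
    if "(x', n') \<in> frac x n" "(y', m') \<in> frac y m" for x' n' y' m'
  proof (subst frac_eq_iff)
    have c: "x' \<in> carrier M" "y' \<in> carrier M" using that by (simp_all add: mem_frac)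
    show "fps_X ^ (n + m) \<odot>\<^bsub>M\<^esub> (fps_X ^ m' \<odot>\<^bsub>M\<^esub> x' \<oplus> fps_X ^ n' \<odot>\<^bsub>M\<^esub> y') =
        fps_X ^ (n' + m') \<odot>\<^bsub>M\<^esub> (fps_X ^ m \<odot>\<^bsub>M\<^esub> x \<oplus> fps_X ^ n \<odot>\<^bsub>M\<^esub> y)"
    proof (rule coord_eqI)
      fix i assume i: "i \<in> coord_index"
      have "fps_X ^ n' * coord i x = fps_X ^ n * coord i x'" "fps_X ^ m' * coord i y = fps_X ^ m * coord i y'"
        using that x y c i unfolding mem_frac by (metis coord_smult)+
      then have "fps_X ^ m * fps_X ^ m' * (fps_X ^ n * coord i x') + fps_X ^ n * fps_X ^ n' * (fps_X ^ m * coord i y') =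
          fps_X ^ m * fps_X ^ m' * (fps_X ^ n' * coord i x) + fps_X ^ n * fps_X ^ n' * (fps_X ^ m' * coord i y)"
        by simp
      then show "coord i (fps_X ^ (n + m) \<odot>\<^bsub>M\<^esub> (fps_X ^ m' \<odot>\<^bsub>M\<^esub> x' \<oplus> fps_X ^ n' \<odot>\<^bsub>M\<^esub> y')) =
          coord i (fps_X ^ (n' + m') \<odot>\<^bsub>M\<^esub> (fps_X ^ m \<odot>\<^bsub>M\<^esub> x \<oplus> fps_X ^ n \<odot>\<^bsub>M\<^esub> y))"
        using x y c i by (simp add: power_add algebra_simps)
    qed (use x y c in simp_all)
  qed (use that x y in \<open>simp_all add: mem_frac\<close>)
  then have "(\<Union>(x, n)\<in>frac x n. \<Union>(y, m)\<in>frac y m. frac (fps_X ^ m \<odot>\<^bsub>M\<^esub> x \<oplus> fps_X ^ n \<odot>\<^bsub>M\<^esub> y) (n + m)) =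
      frac (fps_X ^ m \<odot>\<^bsub>M\<^esub> x \<oplus> fps_X ^ n \<odot>\<^bsub>M\<^esub> y) (n + m)"
    by (rule UN_const_eq[OF frac_self[OF x] UN_const_eq[OF frac_self[OF y]]])
  then show ?thesis by (simp add: localization_def)
qed

lemma frac_smult:
  assumes x: "x \<in> carrier M"
  shows "f \<odot>\<^bsub>L\<^esub> frac x n = frac (f \<odot>\<^bsub>M\<^esub> x) n"
proof -
  have "frac (f \<odot>\<^bsub>M\<^esub> x') n' = frac (f \<odot>\<^bsub>M\<^esub> x) n" if "(x', n') \<in> frac x n" for x' n'
  proof (subst frac_eq_iff)
    have c: "x' \<in> carrier M" "fps_X ^ n' \<odot>\<^bsub>M\<^esub> x = fps_X ^ n \<odot>\<^bsub>M\<^esub> x'" using that by (simp_all add: mem_frac)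
    have "f \<odot>\<^bsub>M\<^esub> (fps_X ^ n' \<odot>\<^bsub>M\<^esub> x) = f \<odot>\<^bsub>M\<^esub> (fps_X ^ n \<odot>\<^bsub>M\<^esub> x')" using c by simp
    then show "fps_X ^ n \<odot>\<^bsub>M\<^esub> (f \<odot>\<^bsub>M\<^esub> x') = fps_X ^ n' \<odot>\<^bsub>M\<^esub> (f \<odot>\<^bsub>M\<^esub> x)"
      using c(1) x by (simp add: sm_assoc mult.commute)
  qed (use that x in \<open>simp_all add: mem_frac\<close>)
  then have "(\<Union>(x, n)\<in>frac x n. frac (f \<odot>\<^bsub>M\<^esub> x) n) = frac (f \<odot>\<^bsub>M\<^esub> x) n"
    by (rule UN_const_eq[OF frac_self[OF x]])
  then show ?thesis by (simp add: localization_def)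
qed

definition aop_frac :: "'e \<Rightarrow> nat \<Rightarrow> 'e"
  where "aop_frac x n = aop M x \<ominus> of_nat n \<odot>\<^bsub>M\<^esub> bop M x"

lemma aop_frac_closed [simp]: "x \<in> carrier M \<Longrightarrow> aop_frac x n \<in> carrier M"
  by (simp add: aop_frac_def bop_def)

lemma coord_aop_frac:
  "i \<in> coord_index \<Longrightarrow> x \<in> carrier M \<Longrightarrow> coord i (aop_frac x n) = coord i (aop M x) - of_nat n * fps_X * coord i x"
  by (simp add: aop_frac_def bop_def)

lemma coord_aop_smult:
  "i \<in> coord_index \<Longrightarrow> x \<in> carrier M \<Longrightarrow>
    coord i (aop M (f \<odot>\<^bsub>M\<^esub> x)) = f * coord i (aop M x) + fps_X\<^sup>2 * fps_deriv f * coord i x"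
  by (simp add: aop_leibniz)

lemma X2_deriv_X_power: "fps_X\<^sup>2 * fps_deriv (fps_X ^ n) = of_nat n * fps_X * (fps_X ^ n :: complex fps)"
  by (induction n) (simp_all add: power2_eq_square algebra_simps)

lemma coord_aop_X_power:
  assumes "i \<in> coord_index" "x \<in> carrier M"
  shows "coord i (aop M (fps_X ^ n \<odot>\<^bsub>M\<^esub> x)) =
    fps_X ^ n * coord i (aop M x) + of_nat n * fps_X * fps_X ^ n * coord i x"
  unfolding coord_aop_smult[OF assms] X2_deriv_X_power ..

lemma frac_aop:
  assumes x: "x \<in> carrier M"
  shows "aop L (frac x n) = frac (aop_frac x n) n"
proof -
  have "frac (aop_frac x' n') n' = frac (aop_frac x n) n" if "(x', n') \<in> frac x n" for x' n'
  proof (subst frac_eq_iff)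
    have c: "x' \<in> carrier M" "fps_X ^ n' \<odot>\<^bsub>M\<^esub> x = fps_X ^ n \<odot>\<^bsub>M\<^esub> x'" using that by (simp_all add: mem_frac)
    show "fps_X ^ n \<odot>\<^bsub>M\<^esub> (aop_frac x' n') = fps_X ^ n' \<odot>\<^bsub>M\<^esub> (aop_frac x n)"
    proof (rule coord_eqI)
      fix i assume i: "i \<in> coord_index"
      have 1: "fps_X ^ n' * coord i x = fps_X ^ n * coord i x'"
        using c x i by (metis coord_smult)
      \<comment> \<open>Applying \<open>a\<close> to the relation between the representatives
        produces terms \<open>n' b\<close> and \<open>n b\<close>. By \<open>1\<close> these
        multiply equal series, so they can change sides and become the corrections in
        \<open>aop_frac\<close>.\<close>
      have "coord i (aop M (fps_X ^ n' \<odot>\<^bsub>M\<^esub> x)) = coord i (aop M (fps_X ^ n \<odot>\<^bsub>M\<^esub> x'))"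
        using c(2) by simp
      then have "fps_X ^ n' * coord i (aop M x) + of_nat n' * fps_X * (fps_X ^ n' * coord i x) =
          fps_X ^ n * coord i (aop M x') + of_nat n * fps_X * (fps_X ^ n * coord i x')"
        using i x c(1) by (simp only: coord_aop_smult X2_deriv_X_power mult.assoc)
      then have "fps_X ^ n' * coord i (aop M x) - of_nat n * fps_X * (fps_X ^ n' * coord i x) =
          fps_X ^ n * coord i (aop M x') - of_nat n' * fps_X * (fps_X ^ n * coord i x')"
        unfolding 1 by (simp add: algebra_simps)
      then show "coord i (fps_X ^ n \<odot>\<^bsub>M\<^esub> aop_frac x' n') = coord i (fps_X ^ n' \<odot>\<^bsub>M\<^esub> aop_frac x n)"
        using i x c(1) by (simp add: coord_aop_frac algebra_simps)
    qed (use x c in simp_all)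
  qed (use that x in \<open>simp_all add: mem_frac\<close>)
  then have "(\<Union>(x, n)\<in>frac x n. frac (aop_frac x n) n) = frac (aop_frac x n) n"
    by (rule UN_const_eq[OF frac_self[OF x]])
  then show ?thesis by (simp add: localization_def aop_frac_def)
qed

lemma frac_eqI:
  assumes "x \<in> carrier M" "y \<in> carrier M"
    and "\<And>i. i \<in> coord_index \<Longrightarrow> fps_X ^ m * coord i x = fps_X ^ n * coord i y"
  shows "frac x n = frac y m"
  using assms by (subst frac_eq_iff) (auto intro!: coord_eqI)

lemma abelian_group_L: "abelian_group L"
proof (rule abelian_groupI)
  fix u v w assume "u \<in> carrier L" "v \<in> carrier L" "w \<in> carrier L"
  then obtain x n y m z k where *: "x \<in> carrier M" "y \<in> carrier M" "z \<in> carrier M"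
    "u = frac x n" "v = frac y m" "w = frac z k"
    by (elim carrier_L_cases) blast
  show "(u \<oplus>\<^bsub>L\<^esub> v) \<oplus>\<^bsub>L\<^esub> w = u \<oplus>\<^bsub>L\<^esub> (v \<oplus>\<^bsub>L\<^esub> w)"
    unfolding * using *(1-3) by (simp add: frac_add) (rule frac_eqI, simp_all add: power_add algebra_simps)
next
  fix u v assume "u \<in> carrier L" "v \<in> carrier L"
  then obtain x n y m where *: "x \<in> carrier M" "y \<in> carrier M" "u = frac x n" "v = frac y m"
    by (elim carrier_L_cases) blast
  show "u \<oplus>\<^bsub>L\<^esub> v \<in> carrier L" unfolding * using *(1,2) by (simp add: frac_add)
  show "u \<oplus>\<^bsub>L\<^esub> v = v \<oplus>\<^bsub>L\<^esub> u"
    unfolding * using *(1,2) by (simp add: frac_add) (rule frac_eqI, simp_all add: power_add algebra_simps)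
next
  fix u assume "u \<in> carrier L"
  then obtain x n where *: "x \<in> carrier M" "u = frac x n" by (elim carrier_L_cases)
  show "\<zero>\<^bsub>L\<^esub> \<oplus>\<^bsub>L\<^esub> u = u"
    unfolding * zero_L using *(1) by (simp add: frac_add)
  have "frac (\<ominus> x) n \<oplus>\<^bsub>L\<^esub> u = \<zero>\<^bsub>L\<^esub>"
    unfolding * zero_L using *(1) by (simp add: frac_add) (rule frac_eqI, simp_all)
  then show "\<exists>v\<in>carrier L. v \<oplus>\<^bsub>L\<^esub> u = \<zero>\<^bsub>L\<^esub>" using *(1) by (intro bexI[of _ "frac (\<ominus> x) n"]) simp_all
qed (simp add: zero_L)

lemma module_L: "module Cb L"
proof (rule moduleI)
  fix f g u assume "u \<in> carrier L"
  then obtain x n where *: "x \<in> carrier M" "u = frac x n" by (elim carrier_L_cases)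
  show "f \<odot>\<^bsub>L\<^esub> u \<in> carrier L" unfolding * using *(1) by (simp add: frac_smult)
  show "(f \<oplus>\<^bsub>Cb\<^esub> g) \<odot>\<^bsub>L\<^esub> u = f \<odot>\<^bsub>L\<^esub> u \<oplus>\<^bsub>L\<^esub> g \<odot>\<^bsub>L\<^esub> u"
    unfolding * using *(1)
    by (simp add: frac_smult frac_add) (rule frac_eqI, simp_all add: power_add algebra_simps)
  show "(f \<otimes>\<^bsub>Cb\<^esub> g) \<odot>\<^bsub>L\<^esub> u = f \<odot>\<^bsub>L\<^esub> (g \<odot>\<^bsub>L\<^esub> u)"
    unfolding * using *(1) by (simp add: frac_smult sm_assoc)
  show "\<one>\<^bsub>Cb\<^esub> \<odot>\<^bsub>L\<^esub> u = u"
    unfolding * using *(1) by (simp add: frac_smult)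
next
  fix f u v assume "u \<in> carrier L" "v \<in> carrier L"
  then obtain x n y m where *: "x \<in> carrier M" "y \<in> carrier M" "u = frac x n" "v = frac y m"
    by (elim carrier_L_cases) blast
  show "f \<odot>\<^bsub>L\<^esub> (u \<oplus>\<^bsub>L\<^esub> v) = f \<odot>\<^bsub>L\<^esub> u \<oplus>\<^bsub>L\<^esub> f \<odot>\<^bsub>L\<^esub> v"
    unfolding * using *(1,2)
    by (simp add: frac_smult frac_add) (rule frac_eqI, simp_all add: power_add algebra_simps)
qed (rule R.cring_axioms, rule abelian_group_L)

lemma X_frac_Suc: "x \<in> carrier M \<Longrightarrow> fps_X \<odot>\<^bsub>L\<^esub> frac x (Suc n) = frac x n"
  by (simp add: frac_smult) (rule frac_eqI, simp_all)

text \<open>Dividing by \<open>b\<close> only raises the denominator, so \<open>b^-1 a\<close> is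
  defined on all of E[b^-1]; regularity concerns the size of the saturation, not the existence of
  this operator.\<close>

lemma simple_pole_L: "simple_pole_module L"
proof (intro simple_pole_module.intro torsion_free_ab.intro torsion_free_ab_axioms.intro
    simple_pole_module_axioms.intro Cb_module.intro)
  show "module Cb L" by (rule module_L)
next
  fix u f assume "u \<in> carrier L"
  then obtain x n where *: "x \<in> carrier M" "u = frac x n" by (elim carrier_L_cases)
  show "aop L u \<in> carrier L" unfolding * using *(1) by (simp add: frac_aop)
  show "aop L (f \<odot>\<^bsub>L\<^esub> u) = f \<odot>\<^bsub>L\<^esub> aop L u \<oplus>\<^bsub>L\<^esub> (fps_X\<^sup>2 * fps_deriv f) \<odot>\<^bsub>L\<^esub> u"
    unfolding * using *(1)
    by (simp add: frac_smult frac_aop frac_add)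
      (rule frac_eqI, simp_all add: power_add coord_aop_frac coord_aop_smult algebra_simps)
  show "\<exists>v\<in>carrier L. fps_X \<odot>\<^bsub>L\<^esub> v = aop L u"
    unfolding * using *(1)
    by (intro bexI[of _ "frac (aop_frac x n) (Suc n)"]) (simp_all add: frac_aop X_frac_Suc)
next
  fix u v assume "u \<in> carrier L" "v \<in> carrier L"
  then obtain x n y m where *: "x \<in> carrier M" "y \<in> carrier M" "u = frac x n" "v = frac y m"
    by (elim carrier_L_cases) blast
  show "aop L (u \<oplus>\<^bsub>L\<^esub> v) = aop L u \<oplus>\<^bsub>L\<^esub> aop L v"
    unfolding * using *(1,2)
    by (simp add: frac_aop frac_add)
      (rule frac_eqI, simp_all add: coord_aop_frac coord_aop_X_power a_add power_add algebra_simps)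
  assume "fps_X \<odot>\<^bsub>L\<^esub> u = fps_X \<odot>\<^bsub>L\<^esub> v"
  then have "frac (fps_X \<odot>\<^bsub>M\<^esub> x) n = frac (fps_X \<odot>\<^bsub>M\<^esub> y) m"
    unfolding * using *(1,2) by (simp add: frac_smult)
  then have "fps_X ^ m \<odot>\<^bsub>M\<^esub> (fps_X \<odot>\<^bsub>M\<^esub> x) = fps_X ^ n \<odot>\<^bsub>M\<^esub> (fps_X \<odot>\<^bsub>M\<^esub> y)"
    using *(1,2) by (subst (asm) frac_eq_iff) simp_all
  then have "fps_X \<odot>\<^bsub>M\<^esub> (fps_X ^ m \<odot>\<^bsub>M\<^esub> x) = fps_X \<odot>\<^bsub>M\<^esub> (fps_X ^ n \<odot>\<^bsub>M\<^esub> y)"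
    using *(1,2) by (simp add: sm_assoc mult.commute)
  from X_inj[OF _ _ this] have "fps_X ^ m \<odot>\<^bsub>M\<^esub> x = fps_X ^ n \<odot>\<^bsub>M\<^esub> y"
    using *(1,2) by simp
  then show "u = v" unfolding * using *(1,2) by (subst frac_eq_iff)
qed

end

section \<open>Saturation\<close>

context ab_module
begin

interpretation L: simple_pole_module L by (rule simple_pole_L)

lemma binva_frac:
  assumes "x \<in> carrier M"
  shows "binva L (frac x n) = frac (aop_frac x n) (Suc n)"
  by (rule L.binva_eqI) (use assms in \<open>simp_all add: frac_aop X_frac_Suc\<close>)

definition sat :: "('e \<times> nat) set set"
  where "sat = carrier (saturation M)"

definition D_frac :: "nat \<Rightarrow> 'e \<Rightarrow> ('e \<times> nat) set"
  where "D_frac k x = (binva L ^^ k) (frac x 0)"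

lemma saturation_eq: "saturation M = L\<lparr>carrier := sat\<rparr>"
  by (simp add: sat_def saturation_def)

lemma sat_iff: "u \<in> sat \<longleftrightarrow> (\<exists>n x. (\<forall>k. x k \<in> carrier M) \<and> u = (\<Oplus>\<^bsub>L\<^esub>k\<in>{..n}. D_frac k (x k)))"
  unfolding sat_def saturation_def D_frac_def by (simp add: conj_commute)

lemma D_frac_closed [simp]: "x \<in> carrier M \<Longrightarrow> D_frac k x \<in> carrier L"
  by (induction k) (simp_all add: D_frac_def)

lemma D_frac_0: "D_frac 0 x = frac x 0"
  and D_frac_Suc: "D_frac (Suc k) x = binva L (D_frac k x)"
  by (simp_all add: D_frac_def)

lemma binva_L_zero: "binva L \<zero>\<^bsub>L\<^esub> = \<zero>\<^bsub>L\<^esub>"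
  using L.binva_leibniz[of "\<zero>\<^bsub>L\<^esub>" 0] by simp

lemma D_frac_zero: "D_frac k \<zero> = \<zero>\<^bsub>L\<^esub>"
  by (induction k) (simp_all add: D_frac_0 D_frac_Suc zero_L[symmetric] binva_L_zero)

lemma D_frac_add:
  assumes "x \<in> carrier M" "y \<in> carrier M"
  shows "D_frac k (x \<oplus> y) = D_frac k x \<oplus>\<^bsub>L\<^esub> D_frac k y"
proof (induction k)
  case 0
  show ?case using assms by (simp add: D_frac_0 frac_add)
next
  case (Suc k)
  then show ?case using assms by (simp add: D_frac_Suc L.binva_add)
qed

text \<open>Elements of the saturation are sums of varying length; padding with zeros lets two of
  them be added term by term.\<close>

lemma finsum_D_frac_pad:
  assumes "\<And>k. x k \<in> carrier M"
  shows "(\<Oplus>\<^bsub>L\<^esub>k\<in>{..n}. D_frac k (x k)) = (\<Oplus>\<^bsub>L\<^esub>k\<in>{..n + j}. D_frac k (if k \<le> n then x k else \<zero>))"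
proof (induction j)
  case 0
  show ?case by (rule L.M.finsum_cong') (use assms in auto)
next
  case (Suc j)
  have "(\<Oplus>\<^bsub>L\<^esub>k\<in>{..Suc (n + j)}. D_frac k (if k \<le> n then x k else \<zero>)) =
      D_frac (Suc (n + j)) \<zero> \<oplus>\<^bsub>L\<^esub> (\<Oplus>\<^bsub>L\<^esub>k\<in>{..n + j}. D_frac k (if k \<le> n then x k else \<zero>))"
    by (subst L.M.finsum_Suc) (use assms in auto)
  also have "\<dots> = (\<Oplus>\<^bsub>L\<^esub>k\<in>{..n + j}. D_frac k (if k \<le> n then x k else \<zero>))"
    using assms by (simp add: D_frac_zero L.M.finsum_closed Pi_iff)
  finally show ?case using Suc by simp
qed

lemma sat_L: "u \<in> sat \<Longrightarrow> u \<in> carrier L"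
  unfolding sat_iff by (elim exE conjE) (simp add: L.M.finsum_closed Pi_iff)

lemma sat_add:
  assumes "u \<in> sat" "v \<in> sat"
  shows "u \<oplus>\<^bsub>L\<^esub> v \<in> sat"
proof -
  obtain n x where x: "\<And>k. x k \<in> carrier M" and u: "u = (\<Oplus>\<^bsub>L\<^esub>k\<in>{..n}. D_frac k (x k))"
    using assms(1) unfolding sat_iff by (elim exE conjE) (rule that, simp_all)
  obtain m y where y: "\<And>k. y k \<in> carrier M" and v: "v = (\<Oplus>\<^bsub>L\<^esub>k\<in>{..m}. D_frac k (y k))"
    using assms(2) unfolding sat_iff by (elim exE conjE) (rule that, simp_all)
  define x' where "x' k = (if k \<le> n then x k else \<zero>)" for k
  define y' where "y' k = (if k \<le> m then y k else \<zero>)" for k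
  have c: "x' k \<in> carrier M" "y' k \<in> carrier M" for k
    using x y by (simp_all add: x'_def y'_def)
  have "u = (\<Oplus>\<^bsub>L\<^esub>k\<in>{..n + m}. D_frac k (x' k))"
    unfolding u x'_def by (rule finsum_D_frac_pad) (rule x)
  moreover have "v = (\<Oplus>\<^bsub>L\<^esub>k\<in>{..n + m}. D_frac k (y' k))"
    unfolding v y'_def by (subst add.commute) (rule finsum_D_frac_pad, rule y)
  ultimately have "u \<oplus>\<^bsub>L\<^esub> v = (\<Oplus>\<^bsub>L\<^esub>k\<in>{..n + m}. D_frac k (x' k) \<oplus>\<^bsub>L\<^esub> D_frac k (y' k))"
    using c by (simp add: L.M.finsum_addf Pi_iff)
  also have "\<dots> = (\<Oplus>\<^bsub>L\<^esub>k\<in>{..n + m}. D_frac k (x' k \<oplus> y' k))"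
    using c by (simp add: D_frac_add)
  finally show ?thesis
    unfolding sat_iff using c by (intro exI[of _ "n + m"] exI[of _ "\<lambda>k. x' k \<oplus> y' k"]) simp
qed

lemma D_frac_sat: "x \<in> carrier M \<Longrightarrow> D_frac k x \<in> sat"
proof -
  assume x: "x \<in> carrier M"
  have "(\<Oplus>\<^bsub>L\<^esub>i\<in>{..k}. D_frac i (if i = k then x else \<zero>)) = (\<Oplus>\<^bsub>L\<^esub>i\<in>{..k}. if k = i then D_frac i x else \<zero>\<^bsub>L\<^esub>)"
    by (rule L.M.finsum_cong') (use x in \<open>auto simp: D_frac_zero\<close>)
  also have "\<dots> = D_frac k x"
    by (rule L.M.finsum_singleton) (use x in auto)
  finally show ?thesis
    unfolding sat_iff using x by (intro exI[of _ k] exI[of _ "\<lambda>i. if i = k then x else \<zero>"]) simp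
qed

lemma frac_sat: "x \<in> carrier M \<Longrightarrow> frac x 0 \<in> sat"
  using D_frac_sat[of x 0] by (simp add: D_frac_0)

text \<open>The saturation is generated from E by sums and \<open>b^-1 a\<close>. Multiplication by
  series is not a case of its own: stability under it is derived by this induction.\<close>

lemma sat_induct [consumes 1, case_names frac add binva]:
  assumes "u \<in> sat"
    and frac: "\<And>x. x \<in> carrier M \<Longrightarrow> P (frac x 0)"
    and add: "\<And>u v. u \<in> sat \<Longrightarrow> v \<in> sat \<Longrightarrow> P u \<Longrightarrow> P v \<Longrightarrow> P (u \<oplus>\<^bsub>L\<^esub> v)"
    and binva: "\<And>u. u \<in> carrier L \<Longrightarrow> P u \<Longrightarrow> P (binva L u)"
  shows "P u"
proof -
  have D: "P (D_frac k x)" if "x \<in> carrier M" for k x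
    by (induction k) (use that frac binva in \<open>simp_all add: D_frac_0 D_frac_Suc\<close>)
  obtain n x where x: "\<And>k. x k \<in> carrier M" and u: "u = (\<Oplus>\<^bsub>L\<^esub>k\<in>{..n}. D_frac k (x k))"
    using assms(1) unfolding sat_iff by (elim exE conjE) (rule that, simp_all)
  have "(\<Oplus>\<^bsub>L\<^esub>k\<in>{..n}. D_frac k (x k)) \<in> sat" for n
    unfolding sat_iff using x by blast
  then have "P (\<Oplus>\<^bsub>L\<^esub>k\<in>{..n}. D_frac k (x k))"
    using x D D_frac_sat add by (induction n) (simp_all add: L.M.finsum_Suc Pi_iff)
  then show ?thesis unfolding u .
qed

lemma sat_binva:
  assumes "u \<in> sat"
  shows "binva L u \<in> sat"
proof -
  obtain n x where x: "\<And>k. x k \<in> carrier M" and u: "u = (\<Oplus>\<^bsub>L\<^esub>k\<in>{..n}. D_frac k (x k))"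
    using assms unfolding sat_iff by (elim exE conjE) (rule that, simp_all)
  have "binva L (\<Oplus>\<^bsub>L\<^esub>k\<in>{..n}. D_frac k (x k)) \<in> sat" for n
  proof (induction n)
    case 0
    have "D_frac 1 (x 0) \<in> sat" using x by (rule D_frac_sat)
    then show ?case using x by (simp add: D_frac_Suc)
  next
    case (Suc n)
    have "D_frac (Suc (Suc n)) (x (Suc n)) \<in> sat" using x by (rule D_frac_sat)
    then show ?case
      using x Suc by (simp add: L.M.finsum_Suc Pi_iff L.binva_add L.M.finsum_closed sat_add D_frac_Suc[symmetric])
  qed
  then show ?thesis unfolding u .
qed

lemma sat_smult:
  assumes "u \<in> sat"
  shows "f \<odot>\<^bsub>L\<^esub> u \<in> sat"
proof -
  \<comment> \<open>Membership of \<open>u\<close> is carried along because the case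
    \<open>binva\<close> supplies only membership in E[b^-1]. All \<open>f\<close> are treated at
    once because \<open>f'\<close> occurs in
    \<open>f b^-1 a u = b^-1 a (f u) - b f' u\<close>.\<close>
  have "u \<in> sat \<and> (\<forall>f. f \<odot>\<^bsub>L\<^esub> u \<in> sat)"
    using assms
  proof (induction u rule: sat_induct)
    case (frac x)
    then show ?case by (simp add: frac_smult frac_sat)
  next
    case (add u v)
    then show ?case by (simp add: sat_add sat_L L.sm_add_r)
  next
    case (binva u)
    have "f \<odot>\<^bsub>L\<^esub> binva L u \<in> sat" for f
    proof -
      have "f \<odot>\<^bsub>L\<^esub> binva L u = f \<odot>\<^bsub>L\<^esub> binva L u \<oplus>\<^bsub>L\<^esub> (fps_X * fps_deriv f + - (fps_X * fps_deriv f)) \<odot>\<^bsub>L\<^esub> u"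
        using binva by simp
      also have "\<dots> = binva L (f \<odot>\<^bsub>L\<^esub> u) \<oplus>\<^bsub>L\<^esub> (- (fps_X * fps_deriv f)) \<odot>\<^bsub>L\<^esub> u"
        using binva by (simp only: L.sm_add L.binva_leibniz) (simp add: L.M.a_assoc)
      finally show ?thesis using binva by (simp add: sat_add sat_binva)
    qed
    then show ?case using binva sat_binva by simp
  qed
  then show ?thesis by simp
qed

lemma submodule_sat: "submodule sat Cb L"
  unfolding L.submodule_iff using frac_sat[of \<zero>] by (auto simp: sat_L sat_add sat_smult zero_L)

lemma simple_pole_saturation: "simple_pole_module (saturation M)"
  unfolding saturation_eq
  by (rule L.simple_pole_submodule[OF submodule_sat]) (use sat_binva sat_L L.X_binva in blast)

text \<open>\<open>binva\<close> searches in the carrier, so its values in the two structures have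
  to be compared.\<close>

lemma binva_saturation:
  assumes "u \<in> sat"
  shows "binva (saturation M) u = binva L u"
proof -
  interpret S: simple_pole_module "saturation M" by (rule simple_pole_saturation)
  show ?thesis
    by (rule S.binva_eqI) (use assms in \<open>simp_all add: saturation_eq sat_binva sat_L L.X_binva\<close>)
qed

lemma aop_frac_eq:
  assumes "x \<in> carrier M"
  shows "aop_frac x n = aop M x \<oplus> (- (of_nat n * fps_X)) \<odot>\<^bsub>M\<^esub> x"
  by (rule coord_eqI) (use assms in \<open>simp_all add: coord_aop_frac\<close>)

text \<open>An embedding \<open>\<phi>\<close> into a simple pole module \<open>G\<close> extends to the saturation, with values in \<open>G\<close>.
  So the coordinates of \<open>G\<close> give coordinates on the saturation.\<close>

lemma ex_coordinates_saturation:
  assumes "regular M"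
  shows "\<exists>(I :: nat set) \<pi>. finite I \<and>
    (\<forall>i\<in>I. \<forall>u\<in>sat. \<forall>v\<in>sat. \<pi> i (u \<oplus>\<^bsub>L\<^esub> v) = \<pi> i u + (\<pi> i v :: complex fps)) \<and>
    (\<forall>i\<in>I. \<forall>u\<in>sat. \<forall>f. \<pi> i (f \<odot>\<^bsub>L\<^esub> u) = f * \<pi> i u) \<and>
    (\<forall>u\<in>sat. (\<forall>i\<in>I. \<pi> i u = 0) \<longrightarrow> u = \<zero>\<^bsub>L\<^esub>)"
proof -
  obtain G :: "(nat \<Rightarrow> complex fps) ab_struct" and \<phi>
    where G: "ab_module G" "simple_pole G" and \<phi>: "\<phi> \<in> ab_hom M G" and inj: "inj_on \<phi> (carrier M)"
    using assms unfolding regular_def by (elim exE conjE bexE) (rule that)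
  interpret G: ab_module G by (rule G)
  have "\<exists>y\<in>carrier G. fps_X \<odot>\<^bsub>G\<^esub> y = aop G x" if "x \<in> carrier G" for x
  proof -
    have "aop G x \<in> bop G ` carrier G" using G(2) that unfolding simple_pole_def by blast
    then obtain y where "y \<in> carrier G" "aop G x = bop G y" by (elim imageE)
    then show ?thesis by (intro bexI[of _ y]) (simp_all add: bop_def)
  qed
  then interpret GP: simple_pole_module G
    by unfold_locales
  have \<phi>_closed [simp]: "\<phi> x \<in> carrier G" if "x \<in> carrier M" for x
    using \<phi> that unfolding ab_hom_def Cb_hom_def by auto
  have \<phi>_add: "\<phi> (x \<oplus> y) = \<phi> x \<oplus>\<^bsub>G\<^esub> \<phi> y" if "x \<in> carrier M" "y \<in> carrier M" for x y
    using \<phi> that unfolding ab_hom_def Cb_hom_def by simp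
  have \<phi>_smult: "\<phi> (f \<odot>\<^bsub>M\<^esub> x) = f \<odot>\<^bsub>G\<^esub> \<phi> x" if "x \<in> carrier M" for f x
    using \<phi> that unfolding ab_hom_def Cb_hom_def by simp
  have \<phi>_a: "\<phi> (aop M x) = aop G (\<phi> x)" if "x \<in> carrier M" for x
    using \<phi> that unfolding ab_hom_def Cb_hom_def by simp
  have \<phi>_zero: "\<phi> \<zero> = \<zero>\<^bsub>G\<^esub>" using \<phi>_smult[of \<zero> 0] by simp
  \<comment> \<open>\<open>R u g\<close> says that the extension of \<open>\<phi>\<close> to E[b^-1]
    takes \<open>u\<close> to \<open>g\<close>. It is a relation because this value in general lies
    only in G[b^-1]; that it lies in \<open>G\<close> on the saturation is shown by
    induction.\<close>
  define R where "R u g \<longleftrightarrow> g \<in> carrier G \<and> (\<exists>x n. x \<in> carrier M \<and> u = frac x n \<and> fps_X ^ n \<odot>\<^bsub>G\<^esub> g = \<phi> x)" for u g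
  have R_E: thesis
    if "R u g" and "\<And>x n. \<lbrakk>g \<in> carrier G; x \<in> carrier M; u = frac x n; fps_X ^ n \<odot>\<^bsub>G\<^esub> g = \<phi> x\<rbrakk> \<Longrightarrow> thesis"
    for u g thesis
    using that(1) unfolding R_def by (elim conjE exE) (rule that(2))
  have R_I: "R (frac x n) g" if "g \<in> carrier G" "x \<in> carrier M" "fps_X ^ n \<odot>\<^bsub>G\<^esub> g = \<phi> x" for x n g
    unfolding R_def using that by (intro conjI exI[of _ x] exI[of _ n]) simp_all
  have R_unique: "g = h" if R1: "R u g" and R2: "R u h" for u g h
  proof -
    obtain x n where x: "x \<in> carrier M" "u = frac x n" "fps_X ^ n \<odot>\<^bsub>G\<^esub> g = \<phi> x"
      by (rule R_E[OF R1])
    obtain y m where y: "y \<in> carrier M" "u = frac y m" "fps_X ^ m \<odot>\<^bsub>G\<^esub> h = \<phi> y"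
      by (rule R_E[OF R2])
    have gh: "g \<in> carrier G" "h \<in> carrier G" using that by (simp_all add: R_def)
    have "fps_X ^ m \<odot>\<^bsub>M\<^esub> x = fps_X ^ n \<odot>\<^bsub>M\<^esub> y"
      using x(2) y(2) by (simp only: frac_eq_iff[OF x(1) y(1), symmetric])
    from arg_cong[of _ _ \<phi>, OF this] have "fps_X ^ m \<odot>\<^bsub>G\<^esub> \<phi> x = fps_X ^ n \<odot>\<^bsub>G\<^esub> \<phi> y"
      using \<phi>_smult x(1) y(1) by simp
    then have "fps_X ^ (m + n) \<odot>\<^bsub>G\<^esub> g = fps_X ^ (m + n) \<odot>\<^bsub>G\<^esub> h"
      unfolding x(3)[symmetric] y(3)[symmetric] using gh by (simp add: G.sm_assoc power_add mult.commute)
    then show ?thesis by (rule G.X_power_inj[OF gh])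
  qed
  have R_add: "R (u \<oplus>\<^bsub>L\<^esub> v) (g \<oplus>\<^bsub>G\<^esub> h)" if R1: "R u g" and R2: "R v h" for u v g h
  proof -
    obtain x n where x: "x \<in> carrier M" "u = frac x n" "fps_X ^ n \<odot>\<^bsub>G\<^esub> g = \<phi> x"
      by (rule R_E[OF R1])
    obtain y m where y: "y \<in> carrier M" "v = frac y m" "fps_X ^ m \<odot>\<^bsub>G\<^esub> h = \<phi> y"
      by (rule R_E[OF R2])
    have gh: "g \<in> carrier G" "h \<in> carrier G" using that by (simp_all add: R_def)
    have "fps_X ^ (n + m) \<odot>\<^bsub>G\<^esub> (g \<oplus>\<^bsub>G\<^esub> h) = \<phi> (fps_X ^ m \<odot>\<^bsub>M\<^esub> x \<oplus> fps_X ^ n \<odot>\<^bsub>M\<^esub> y)"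
      using x(1) y(1) gh
      by (simp add: \<phi>_add \<phi>_smult x(3)[symmetric] y(3)[symmetric] G.sm_assoc G.sm_add_r power_add mult.commute)
    then show ?thesis
      unfolding x(2) y(2) frac_add[OF x(1) y(1)]
      by (intro R_I) (use x(1) y(1) gh in simp_all)
  qed
  have R_smult: "R (f \<odot>\<^bsub>L\<^esub> u) (f \<odot>\<^bsub>G\<^esub> g)" if R1: "R u g" for u g f
  proof -
    obtain x n where x: "x \<in> carrier M" "u = frac x n" "fps_X ^ n \<odot>\<^bsub>G\<^esub> g = \<phi> x"
      by (rule R_E[OF R1])
    have g: "g \<in> carrier G" using that by (simp add: R_def)
    have "fps_X ^ n \<odot>\<^bsub>G\<^esub> (f \<odot>\<^bsub>G\<^esub> g) = \<phi> (f \<odot>\<^bsub>M\<^esub> x)"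
      using x(1) g by (simp add: \<phi>_smult x(3)[symmetric] G.sm_assoc mult.commute)
    then show ?thesis
      unfolding x(2) frac_smult[OF x(1)]
      by (intro R_I) (use x(1) g in simp_all)
  qed
  have R_binva: "R (binva L u) (binva G g)" if R1: "R u g" for u g
  proof -
    obtain x n where x: "x \<in> carrier M" "u = frac x n" "fps_X ^ n \<odot>\<^bsub>G\<^esub> g = \<phi> x"
      by (rule R_E[OF R1])
    have g: "g \<in> carrier G" using that by (simp add: R_def)
    have "fps_X ^ Suc n \<odot>\<^bsub>G\<^esub> binva G g = fps_X ^ n \<odot>\<^bsub>G\<^esub> (fps_X \<odot>\<^bsub>G\<^esub> binva G g)"
      using g by (simp add: G.sm_assoc mult.commute)
    also have "\<dots> = fps_X ^ n \<odot>\<^bsub>G\<^esub> aop G g"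
      using g by (simp add: GP.X_binva)
    \<comment> \<open>Moving \<open>a\<close> past \<open>b^n\<close> in \<open>G\<close> costs
      \<open>n b^(n+1)\<close>, the same correction that \<open>aop_frac\<close> subtracts.\<close>
    also have "\<dots> = \<phi> (aop_frac x n)"
    proof (rule G.coord_eqI)
      fix i assume i: "i \<in> G.coord_index"
      show "G.coord i (fps_X ^ n \<odot>\<^bsub>G\<^esub> aop G g) = G.coord i (\<phi> (aop_frac x n))"
        using i g x(1) 
        by (simp add: aop_frac_eq \<phi>_add \<phi>_smult \<phi>_a x(3)[symmetric] G.coord_aop_X_power algebra_simps)
    qed (use g x in simp_all)
    finally show ?thesis
      unfolding x(2) binva_frac[OF x(1)]
      by (intro R_I) (use x(1) g in simp_all)
  qed
  have "\<exists>g. R u g" if "u \<in> sat" for u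
    using that
  proof (induction u rule: sat_induct)
    case (frac x)
    then have "R (frac x 0) (\<phi> x)"
      by (intro R_I) simp_all
    then show ?case by blast
  qed (use R_add R_binva in blast)+
  then obtain \<Psi> where \<Psi>: "R u (\<Psi> u)" if "u \<in> sat" for u by metis
  have \<Psi>_closed: "\<Psi> u \<in> carrier G" if "u \<in> sat" for u
    using \<Psi>[OF that] unfolding R_def by simp
  have \<Psi>_add: "\<Psi> (u \<oplus>\<^bsub>L\<^esub> v) = \<Psi> u \<oplus>\<^bsub>G\<^esub> \<Psi> v" if "u \<in> sat" "v \<in> sat" for u v
    using R_unique[OF \<Psi>[OF sat_add[OF that]] R_add[OF \<Psi>[OF that(1)] \<Psi>[OF that(2)]]] .
  have \<Psi>_smult: "\<Psi> (f \<odot>\<^bsub>L\<^esub> u) = f \<odot>\<^bsub>G\<^esub> \<Psi> u" if "u \<in> sat" for f u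
    using R_unique[OF \<Psi>[OF sat_smult[OF that]] R_smult[OF \<Psi>[OF that]]] .
  have \<Psi>_inj: "u = \<zero>\<^bsub>L\<^esub>" if u: "u \<in> sat" and 0: "\<And>i. i \<in> G.coord_index \<Longrightarrow> G.coord i (\<Psi> u) = 0" for u
  proof -
    have "\<Psi> u = \<zero>\<^bsub>G\<^esub>" using G.coord_eq_0[OF \<Psi>_closed[OF u]] 0 by simp
    moreover obtain x n where x: "x \<in> carrier M" "u = frac x n" "fps_X ^ n \<odot>\<^bsub>G\<^esub> \<Psi> u = \<phi> x"
      by (rule R_E[OF \<Psi>[OF u]])
    ultimately have "\<phi> x = \<phi> \<zero>" by (simp add: \<phi>_zero)
    then have "x = \<zero>" using inj_onD[OF inj] x(1) by simp
    then show ?thesis unfolding x(2) zero_L by (simp add: frac_eq_iff)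
  qed
  show ?thesis
    by (intro exI[of _ G.coord_index] exI[of _ "\<lambda>i u. G.coord i (\<Psi> u)"])
      (use \<Psi>_inj in \<open>simp add: \<Psi>_add \<Psi>_smult \<Psi>_closed\<close>)
qed

end

section \<open>The residue pairing\<close>

lemma X_power_dvd_iff: "fps_X ^ n dvd (f :: complex fps) \<longleftrightarrow> (\<forall>i<n. f $ i = 0)"
proof
  assume "fps_X ^ n dvd f"
  then obtain g where "f = fps_X ^ n * g" by (elim dvdE)
  then show "\<forall>i<n. f $ i = 0" by (simp add: fps_X_power_mult_nth)
next
  assume *: "\<forall>i<n. f $ i = 0"
  have "f = fps_X ^ n * fps_shift n f"
    by (rule fps_ext) (use * in \<open>simp add: fps_X_power_mult_nth\<close>)
  then show "fps_X ^ n dvd f" by (rule dvdI)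
qed

text \<open>After division by \<open>b^n\<close> this is evaluation at \<open>b = 0\<close>, which
  is multiplicative.\<close>

lemma nth_mult_of_X_power_dvd:
  assumes "fps_X ^ n dvd (g :: complex fps)"
  shows "(f * g) $ n = f $ 0 * g $ n"
proof -
  obtain h where "g = fps_X ^ n * h" using assms by (elim dvdE)
  then have "f * g = fps_X ^ n * (f * h)" "g = fps_X ^ n * h" by simp_all
  then show ?thesis by (simp only: fps_X_power_mult_nth) simp
qed

text \<open>The derivative loses one order and \<open>b^2\<close> restores two; for
  \<open>n = 0\<close> the factor \<open>b^2\<close> suffices.\<close>

lemma X_power_Suc_dvd_X2_deriv:
  assumes "fps_X ^ n dvd (f :: complex fps)"
  shows "fps_X ^ Suc n dvd fps_X\<^sup>2 * fps_deriv f"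
proof -
  have "(fps_X * (fps_X * fps_deriv f)) $ i = 0" if "i < Suc n" for i
    using assms that unfolding X_power_dvd_iff by (cases i; cases "i - 1") (simp_all add: fps_X_mult_nth)
  then show ?thesis
    unfolding X_power_dvd_iff by (simp add: power2_eq_square mult.assoc)
qed

lemma X_power_cancel_dvd:
  "fps_X ^ (n + m) dvd fps_X ^ m * (f :: complex fps) \<longleftrightarrow> fps_X ^ n dvd f"
  by (simp add: power_add mult.commute[of "fps_X ^ n"])

text \<open>The hypotheses of the theorem in terms of the pairing \<open>\<kappa> x y\<close>.
  \<open>k_aop\<close> is \<open>\<kappa> (- a x) = a \<kappa> x\<close> evaluated at
  \<open>y\<close>; the signs from \<open>check\<close> and from the action on Hom cancel, so
  \<open>k (aop M x) y\<close> appears with a plus. \<open>k_inj\<close> and \<open>k_surj\<close>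
  express bijectivity of \<open>\<kappa>\<close>, that is, perfectness over C[[b]].\<close>

locale ab_duality = ab_module M for M :: "('e, 'm) ab_struct_scheme" (structure) +
  fixes k :: "'e \<Rightarrow> 'e \<Rightarrow> complex fps" and \<delta> :: complex
  assumes k_add_left: "\<lbrakk>x \<in> carrier M; x' \<in> carrier M; y \<in> carrier M\<rbrakk> \<Longrightarrow> k (x \<oplus> x') y = k x y + k x' y"
    and k_add_right: "\<lbrakk>x \<in> carrier M; y \<in> carrier M; y' \<in> carrier M\<rbrakk> \<Longrightarrow> k x (y \<oplus> y') = k x y + k x y'"
    and k_smult_left: "\<lbrakk>x \<in> carrier M; y \<in> carrier M\<rbrakk> \<Longrightarrow> k (f \<odot>\<^bsub>M\<^esub> x) y = fps_compose f (- fps_X) * k x y"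
    and k_smult_right: "\<lbrakk>x \<in> carrier M; y \<in> carrier M\<rbrakk> \<Longrightarrow> k x (f \<odot>\<^bsub>M\<^esub> y) = f * k x y"
    and k_aop: "\<lbrakk>x \<in> carrier M; y \<in> carrier M\<rbrakk> \<Longrightarrow>
      k x (aop M y) = k (aop M x) y + fps_const \<delta> * fps_X * k x y + fps_X\<^sup>2 * fps_deriv (k x y)"
    and k_inj: "\<lbrakk>x \<in> carrier M; x' \<in> carrier M; \<And>y. y \<in> carrier M \<Longrightarrow> k x y = k x' y\<rbrakk> \<Longrightarrow> x = x'"
    and k_surj: "\<lbrakk>\<And>y y'. y \<in> carrier M \<Longrightarrow> y' \<in> carrier M \<Longrightarrow> h (y \<oplus> y') = h y + h y';
        \<And>f y. y \<in> carrier M \<Longrightarrow> h (f \<odot>\<^bsub>M\<^esub> y) = f * h y\<rbrakk> \<Longrightarrow>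
      \<exists>x\<in>carrier M. \<forall>y\<in>carrier M. k x y = h y"
    and regular: "regular M"
begin

interpretation L: simple_pole_module L by (rule simple_pole_L)

lemma k_X_left: "x \<in> carrier M \<Longrightarrow> y \<in> carrier M \<Longrightarrow> k (fps_X \<odot>\<^bsub>M\<^esub> x) y = - fps_X * k x y"
  by (simp add: k_smult_left)

lemma k_aop_frac:
  assumes "x \<in> carrier M" "y \<in> carrier M"
  shows "k x (aop_frac y n) = k x (aop M y) - of_nat n * fps_X * k x y"
  using assms by (simp add: aop_frac_eq k_add_right k_smult_right)

text \<open>Integrality of the extended pairing, expressed without Laurent series. Quantifying over
  all representations makes it a property of the class \<open>u\<close>.\<close>

definition integral :: "'e \<Rightarrow> ('e \<times> nat) set \<Rightarrow> bool"
  where "integral x u \<longleftrightarrow> (\<forall>y n. y \<in> carrier M \<longrightarrow> u = frac y n \<longrightarrow> fps_X ^ n dvd k x y)"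

lemma integral_frac:
  assumes x: "x \<in> carrier M" and y: "y \<in> carrier M"
  shows "integral x (frac y n) \<longleftrightarrow> fps_X ^ n dvd k x y"
proof
  assume "fps_X ^ n dvd k x y"
  have "fps_X ^ m dvd k x z" if z: "z \<in> carrier M" and eq: "frac y n = frac z m" for z m
  proof -
    have "fps_X ^ m \<odot>\<^bsub>M\<^esub> y = fps_X ^ n \<odot>\<^bsub>M\<^esub> z"
      using eq by (simp only: frac_eq_iff[OF y z])
    from arg_cong[of _ _ "k x", OF this] have "fps_X ^ m * k x y = fps_X ^ n * k x z"
      using x y z by (simp only: k_smult_right)
    moreover have "fps_X ^ (m + n) dvd fps_X ^ m * k x y"
      using \<open>fps_X ^ n dvd k x y\<close> by (subst add.commute, subst X_power_cancel_dvd)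
    ultimately have "fps_X ^ (m + n) dvd fps_X ^ n * k x z" by simp
    then show ?thesis unfolding X_power_cancel_dvd .
  qed
  then show "integral x (frac y n)" unfolding integral_def by simp
qed (use y in \<open>simp add: integral_def\<close>)

text \<open>The value at \<open>b = 0\<close> of \<open>k x (b\<^sup>-\<^sup>n y) = b\<^sup>-\<^sup>n k x y\<close>; integrality of \<open>x\<close> at the fraction
  \<open>b\<^sup>-\<^sup>n y\<close> means that this is a power series.\<close>

definition residue :: "'e \<Rightarrow> ('e \<times> nat) set \<Rightarrow> complex"
  where "residue x u = (THE c. \<exists>y n. y \<in> carrier M \<and> u = frac y n \<and> c = k x y $ n)"

lemma residue_frac:
  assumes x: "x \<in> carrier M" and y: "y \<in> carrier M"
  shows "residue x (frac y n) = k x y $ n"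
  unfolding residue_def
proof (rule the_equality)
  show "\<exists>y' n'. y' \<in> carrier M \<and> frac y n = frac y' n' \<and> k x y $ n = k x y' $ n'"
    using y by (intro exI[of _ y] exI[of _ n]) simp
next
  fix c assume "\<exists>y' n'. y' \<in> carrier M \<and> frac y n = frac y' n' \<and> c = k x y' $ n'"
  then obtain z m where z: "z \<in> carrier M" and eq: "frac y n = frac z m" and c: "c = k x z $ m"
    by (elim exE conjE) (rule that)
  have "fps_X ^ m \<odot>\<^bsub>M\<^esub> y = fps_X ^ n \<odot>\<^bsub>M\<^esub> z"
    using eq by (simp only: frac_eq_iff[OF y z])
  from arg_cong[of _ _ "k x", OF this] have "fps_X ^ m * k x y = fps_X ^ n * k x z"
    using x y z by (simp only: k_smult_right)
  from arg_cong[of _ _ "\<lambda>f. f $ (n + m)", OF this] show "c = k x y $ n"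
    by (simp add: c fps_X_power_mult_nth)
qed

section \<open>The biggest simple pole submodule\<close>

text \<open>This gives the maximality of the dual lattice. The induction over the saturation keeps
  \<open>x\<close> ranging over all of \<open>N\<close>, because integrality at
  \<open>b^-1 a u\<close> is reduced to that of \<open>x\<close> and of \<open>b^-1 a x\<close> at
  \<open>u\<close>.\<close>

lemma simple_pole_integral:
  assumes N: "N \<subseteq> carrier M" and pole: "\<And>x. x \<in> N \<Longrightarrow> \<exists>x'\<in>N. fps_X \<odot>\<^bsub>M\<^esub> x' = aop M x"
    and u: "u \<in> sat" and x: "x \<in> N"
  shows "integral x u"
proof -
  have "\<forall>x\<in>N. integral x u"
    using u
  proof (induction u rule: sat_induct)
    case (frac y)
    then show ?case using N by (auto simp: integral_frac)
  next
    case (add u v)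
    obtain y n where y: "y \<in> carrier M" "u = frac y n"
      using sat_L[OF add.hyps(1)] by (rule carrier_L_cases)
    obtain z m where z: "z \<in> carrier M" "v = frac z m"
      using sat_L[OF add.hyps(2)] by (rule carrier_L_cases)
    have "fps_X ^ (n + m) dvd fps_X ^ m * k x y + fps_X ^ n * k x z" if "x \<in> N" for x
    proof (rule dvd_add)
      have x: "x \<in> carrier M" using that N by blast
      have "fps_X ^ n dvd k x y"
        using bspec[OF add.IH(1) that] unfolding y(2) integral_frac[OF x y(1)] .
      moreover have "fps_X ^ m dvd k x z"
        using bspec[OF add.IH(2) that] unfolding z(2) integral_frac[OF x z(1)] .
      ultimately show "fps_X ^ (n + m) dvd fps_X ^ m * k x y" "fps_X ^ (n + m) dvd fps_X ^ n * k x z"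
        using X_power_cancel_dvd[of n m "k x y"] X_power_cancel_dvd[of m n "k x z"]
        by (simp_all add: add.commute)
    qed
    then show ?case
      using N y z by (auto simp: frac_add integral_frac k_add_right k_smult_right subset_iff)
  next
    case (binva u)
    obtain y n where y: "y \<in> carrier M" "u = frac y n"
      using binva.hyps by (rule carrier_L_cases)
    show ?case
    proof
      fix x assume "x \<in> N"
      then obtain x' where x': "x' \<in> N" "fps_X \<odot>\<^bsub>M\<^esub> x' = aop M x" using pole by blast
      have c: "x \<in> carrier M" "x' \<in> carrier M" using N x'(1) \<open>x \<in> N\<close> by auto
      have d: "fps_X ^ n dvd k x y" "fps_X ^ n dvd k x' y"
        using binva.IH \<open>x \<in> N\<close> x'(1) c y by (auto simp: integral_frac)
      \<comment> \<open>The common factor \<open>b\<close> supplies the extra order demanded by the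
        denominator \<open>b^(n+1)\<close> of \<open>b^-1 a u\<close>; the sign before
        \<open>k x' y\<close> comes from sesquilinearity.\<close>
      have "k x (aop_frac y n) =
          fps_X * (- k x' y + fps_const \<delta> * k x y - of_nat n * k x y) + fps_X\<^sup>2 * fps_deriv (k x y)"
        using c y(1) by (simp add: k_aop_frac k_aop x'(2)[symmetric] k_X_left algebra_simps)
      moreover have "fps_X ^ Suc n dvd fps_X * (- k x' y + fps_const \<delta> * k x y - of_nat n * k x y)"
        unfolding power_Suc by (rule mult_dvd_mono[OF dvd_refl]) (use d in simp)
      ultimately have "fps_X ^ Suc n dvd k x (aop_frac y n)"
        using X_power_Suc_dvd_X2_deriv[OF d(1)] by (metis dvd_add)
      then show "integral x (binva L u)"
        unfolding y(2) binva_frac[OF y(1)] using c y(1) by (simp add: integral_frac del: power_Suc)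
    qed
  qed
  then show ?thesis using x by blast
qed

text \<open>The dual lattice of the saturation. It is sought inside E because the saturation
  contains E: whatever pairs integrally with E is already in E, by perfectness.\<close>

definition dual_sat :: "'e set"
  where "dual_sat = {x \<in> carrier M. \<forall>u\<in>sat. integral x u}"

lemma dual_satD:
  assumes "x \<in> dual_sat" "y \<in> carrier M" "frac y n \<in> sat"
  shows "fps_X ^ n dvd k x y"
  using assms integral_frac unfolding dual_sat_def by blast

lemma dual_sat_carrier: "x \<in> dual_sat \<Longrightarrow> x \<in> carrier M"
  by (simp add: dual_sat_def)

lemma dual_satI:
  assumes x: "x \<in> carrier M"
    and "\<And>y n. y \<in> carrier M \<Longrightarrow> frac y n \<in> sat \<Longrightarrow> fps_X ^ n dvd k x y"
  shows "x \<in> dual_sat"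
  unfolding dual_sat_def integral_def
  by (intro CollectI conjI ballI allI impI) (use assms in simp_all)

lemma k_zero_left: "y \<in> carrier M \<Longrightarrow> k \<zero> y = 0"
  using k_smult_left[of \<zero> y 0] by simp

lemma submodule_dual_sat: "submodule dual_sat Cb M"
  unfolding submodule_iff
proof (intro conjI ballI allI)
  show "\<zero> \<in> dual_sat" by (rule dual_satI) (simp_all add: k_zero_left)
  show "x \<oplus> y \<in> dual_sat" if xy: "x \<in> dual_sat" "y \<in> dual_sat" for x y
    by (rule dual_satI) (use xy dual_satD dual_sat_carrier in \<open>simp_all add: k_add_left\<close>)
  show "f \<odot>\<^bsub>M\<^esub> x \<in> dual_sat" if x: "x \<in> dual_sat" for x f
    by (rule dual_satI) (use x dual_satD dual_sat_carrier in \<open>simp_all add: k_smult_left\<close>)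
qed (use dual_sat_carrier in blast)

text \<open>When all values of \<open>k z\<close> are divisible by \<open>b\<close>, the quotient
  functional is again represented by an element of E. The minus sign in the proof makes up for
  \<open>k (b x) y = - b k x y\<close>.\<close>

lemma X_dvd_k_imp:
  assumes z: "z \<in> carrier M" and dvd: "\<And>y. y \<in> carrier M \<Longrightarrow> fps_X dvd k z y"
  shows "\<exists>x\<in>carrier M. fps_X \<odot>\<^bsub>M\<^esub> x = z"
proof -
  have "\<exists>x\<in>carrier M. \<forall>y\<in>carrier M. k x y = - (k z y div fps_X)"
  proof (rule k_surj)
    show "- (k z (y \<oplus> y') div fps_X) = - (k z y div fps_X) + - (k z y' div fps_X)"
      if "y \<in> carrier M" "y' \<in> carrier M" for y y'
      using that z dvd by (simp add: k_add_right fps_shift_add)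
    show "- (k z (f \<odot>\<^bsub>M\<^esub> y) div fps_X) = f * - (k z y div fps_X)" if "y \<in> carrier M" for f y
      unfolding k_smult_right[OF z that] div_mult_swap[OF dvd[OF that], symmetric] by simp
  qed
  then obtain x where x: "x \<in> carrier M" "\<forall>y\<in>carrier M. k x y = - (k z y div fps_X)"
    by (elim bexE)
  have "fps_X \<odot>\<^bsub>M\<^esub> x = z"
  proof (rule k_inj)
    fix y assume y: "y \<in> carrier M"
    have "fps_X * (k z y div fps_X) = k z y" using dvd[OF y] by (rule dvd_mult_div_cancel)
    then show "k (fps_X \<odot>\<^bsub>M\<^esub> x) y = k z y"
      unfolding k_X_left[OF x(1) y] bspec[OF x(2) y] by (simp only: minus_mult_minus)
  qed (use x(1) z in simp_all)
  then show ?thesis using x(1) by blast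
qed

text \<open>Both the simple pole of the dual lattice and the left nondegeneracy modulo
  \<open>b\<close> are instances: each comes down to one extra factor \<open>b\<close> in the
  pairings with the saturation.\<close>

lemma dual_sat_div_X:
  assumes z: "z \<in> carrier M"
    and dvd: "\<And>y n. y \<in> carrier M \<Longrightarrow> frac y n \<in> sat \<Longrightarrow> fps_X ^ Suc n dvd k z y"
  shows "\<exists>x\<in>dual_sat. fps_X \<odot>\<^bsub>M\<^esub> x = z"
proof -
  \<comment> \<open>The case \<open>n = 0\<close>, available since E lies in the saturation.\<close>
  have "fps_X dvd k z y" if "y \<in> carrier M" for y
    using dvd[OF that frac_sat[OF that]] by simp
  then obtain x where x: "x \<in> carrier M" "fps_X \<odot>\<^bsub>M\<^esub> x = z"
    using X_dvd_k_imp[OF z] by blast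
  have "x \<in> dual_sat"
  proof (rule dual_satI[OF x(1)])
    fix y n assume y: "y \<in> carrier M" "frac y n \<in> sat"
    have "k z y = fps_X * - k x y"
      using k_X_left[OF x(1) y(1)] unfolding x(2) by simp
    then have "fps_X * fps_X ^ n dvd fps_X * - k x y"
      using dvd[OF y] by simp
    then show "fps_X ^ n dvd k x y"
      by (simp only: dvd_times_left_cancel_iff[OF fps_X_neq_zero] dvd_minus_iff)
  qed
  then show ?thesis using x(2) by blast
qed

lemma dual_sat_pole:
  assumes x: "x \<in> dual_sat"
  shows "\<exists>x'\<in>dual_sat. fps_X \<odot>\<^bsub>M\<^esub> x' = aop M x"
proof (rule dual_sat_div_X)
  note xM = dual_sat_carrier[OF x]
  show "aop M x \<in> carrier M" using xM by simp
  fix y n assume y: "y \<in> carrier M" "frac y n \<in> sat"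
  have d: "fps_X ^ n dvd k x y" using dual_satD[OF x y] .
  \<comment> \<open>This fraction is \<open>b^-1 a\<close> applied to \<open>b^-n y\<close>; its
    membership in the saturation provides the extra order.\<close>
  have "frac (aop_frac y n) (Suc n) \<in> sat"
    using sat_binva[OF y(2)] unfolding binva_frac[OF y(1)] .
  then have 1: "fps_X ^ Suc n dvd k x (aop_frac y n)"
    using dual_satD[OF x aop_frac_closed[OF y(1)]] by blast
  have 2: "fps_X ^ Suc n dvd fps_X * (of_nat n * k x y - fps_const \<delta> * k x y)"
    unfolding power_Suc by (rule mult_dvd_mono[OF dvd_refl]) (use d in simp)
  have "k (aop M x) y = k x (aop_frac y n) + fps_X * (of_nat n * k x y - fps_const \<delta> * k x y) - fps_X\<^sup>2 * fps_deriv (k x y)"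
    using xM y(1) by (simp add: k_aop_frac k_aop algebra_simps)
  then show "fps_X ^ Suc n dvd k (aop M x) y"
    using dvd_diff[OF dvd_add[OF 1 2] X_power_Suc_dvd_X2_deriv[OF d]] by (simp only:)
qed

text \<open>\<open>GREATEST\<close> has a value here because \<open>dual_sat\<close> itself has a
  simple pole and, by \<open>simple_pole_integral\<close>, contains every simple pole
  submodule.\<close>

lemma biggest_simple_pole_eq: "biggest_simple_pole M = M\<lparr>carrier := dual_sat\<rparr>"
proof -
  have "(GREATEST N. sub_ab_module N M \<and> simple_pole (M\<lparr>carrier := N\<rparr>)) = dual_sat"
  proof (rule Greatest_equality)
    have "aop M x \<in> bop M ` dual_sat \<and> aop M x \<in> dual_sat" if x: "x \<in> dual_sat" for x
    proof -
      obtain x' where "x' \<in> dual_sat" "fps_X \<odot>\<^bsub>M\<^esub> x' = aop M x"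
        using dual_sat_pole[OF x] by blast
      then show ?thesis
        using submodule_dual_sat unfolding submodule_iff by (auto simp: bop_def simp flip: \<open>_ = aop M x\<close>)
    qed
    then show "sub_ab_module dual_sat M \<and> simple_pole (M\<lparr>carrier := dual_sat\<rparr>)"
      unfolding sub_ab_module_def simple_pole_def using submodule_dual_sat by (auto simp: bop_def)
  next
    fix N assume N: "sub_ab_module N M \<and> simple_pole (M\<lparr>carrier := N\<rparr>)"
    then have NM: "N \<subseteq> carrier M" unfolding sub_ab_module_def submodule_iff by simp
    have "\<exists>x'\<in>N. fps_X \<odot>\<^bsub>M\<^esub> x' = aop M x" if "x \<in> N" for x
    proof -
      have "aop M x \<in> (\<lambda>x'. fps_X \<odot>\<^bsub>M\<^esub> x') ` N"
        using N that unfolding simple_pole_def bop_def by auto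
      then obtain x' where "x' \<in> N" "aop M x = fps_X \<odot>\<^bsub>M\<^esub> x'" by (elim imageE)
      then show ?thesis by (intro bexI[of _ x']) simp_all
    qed
    from simple_pole_integral[OF NM this] show "N \<le> dual_sat"
      unfolding dual_sat_def using NM by blast
  qed
  then show ?thesis by (simp add: biggest_simple_pole_def)
qed

lemma simple_pole_dual_sat: "simple_pole_module (M\<lparr>carrier := dual_sat\<rparr>)"
  by (rule simple_pole_submodule[OF submodule_dual_sat dual_sat_pole])

section \<open>Nondegeneracy of the residue pairing\<close>

lemma residue_nondegenerate_left:
  assumes x: "x \<in> dual_sat" and 0: "\<And>u. u \<in> sat \<Longrightarrow> residue x u = 0"
  shows "\<exists>x'\<in>dual_sat. x = fps_X \<odot>\<^bsub>M\<^esub> x'"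
proof -
  have "\<exists>x'\<in>dual_sat. fps_X \<odot>\<^bsub>M\<^esub> x' = x"
  proof (rule dual_sat_div_X)
    fix y n assume y: "y \<in> carrier M" "frac y n \<in> sat"
    \<comment> \<open>Integrality kills the coefficients below \<open>n\<close>; the vanishing
      residue kills the \<open>n\<close>-th.\<close>
    have "k x y $ n = 0"
      using 0[OF y(2)] residue_frac[OF dual_sat_carrier[OF x] y(1)] by simp
    then show "fps_X ^ Suc n dvd k x y"
      using dual_satD[OF x y] unfolding X_power_dvd_iff by (simp add: less_Suc_eq)
  qed (use x dual_sat_carrier in simp)
  then show ?thesis by auto
qed

text \<open>If \<open>u\<close> is not in the image of \<open>b\<close>, some functional of a dual system on the saturation takes
  a unit value at \<open>u\<close>; its restriction to \<open>M\<close> is \<open>k x\<close> for some \<open>x\<close>, which lies in \<open>dual_sat\<close>.\<close>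

lemma residue_nondegenerate_right:
  assumes u: "u \<in> sat" and 0: "\<And>x. x \<in> dual_sat \<Longrightarrow> residue x u = 0"
  shows "\<exists>v\<in>sat. u = fps_X \<odot>\<^bsub>L\<^esub> v"
proof -
  obtain I :: "nat set" and \<pi> where I: "finite I"
    and \<pi>: "\<forall>i\<in>I. \<forall>u\<in>sat. \<forall>v\<in>sat. \<pi> i (u \<oplus>\<^bsub>L\<^esub> v) = \<pi> i u + (\<pi> i v :: complex fps)"
      "\<forall>i\<in>I. \<forall>u\<in>sat. \<forall>f. \<pi> i (f \<odot>\<^bsub>L\<^esub> u) = f * \<pi> i u"
      "\<forall>u\<in>sat. (\<forall>i\<in>I. \<pi> i u = 0) \<longrightarrow> u = \<zero>\<^bsub>L\<^esub>"
    using ex_coordinates_saturation[OF regular] by (elim exE conjE) (rule that)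
  have "\<exists>s c. L.dual_system I sat s c"
    by (rule L.ex_dual_system[OF I submodule_sat, of \<pi>]) (use \<pi> in simp_all)
  then obtain s c where sc: "L.dual_system I sat s c" by (elim exE)
  note s = L.dual_systemD(1)[OF sc] and c_add = L.dual_systemD(2)[OF sc]
    and c_smult = L.dual_systemD(3)[OF sc] and gen = L.dual_systemD(4)[OF sc]
  have c0: "c i u $ 0 = 0" if i: "i \<in> I" for i
  proof -
    have "\<exists>x\<in>carrier M. \<forall>y\<in>carrier M. k x y = c i (frac y 0)"
    proof (rule k_surj)
      show "c i (frac (y \<oplus> y') 0) = c i (frac y 0) + c i (frac y' 0)"
        if "y \<in> carrier M" "y' \<in> carrier M" for y y'
        using c_add[OF i frac_sat frac_sat, of y y'] that by (simp add: frac_add)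
      show "c i (frac (f \<odot>\<^bsub>M\<^esub> y) 0) = f * c i (frac y 0)" if "y \<in> carrier M" for f y
        using c_smult[OF i frac_sat, of y f] that by (simp add: frac_smult)
    qed
    then obtain x where x: "x \<in> carrier M" "\<forall>y\<in>carrier M. k x y = c i (frac y 0)"
      by (elim bexE)
    \<comment> \<open>By linearity \<open>c i\<close> extends \<open>k x\<close> from E to the
      saturation. This shows both that \<open>x\<close> pairs integrally with the saturation and
      that its residue at \<open>u\<close> is \<open>c i u $ 0\<close>.\<close>
    have key: "k x y = fps_X ^ n * c i (frac y n)" if y: "y \<in> carrier M" "frac y n \<in> sat" for y n
    proof -
      have "fps_X ^ n \<odot>\<^bsub>L\<^esub> frac y n = frac y 0"
        unfolding frac_smult[OF y(1)] by (rule frac_eqI) (use y in simp_all)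
      then show ?thesis using c_smult[OF i y(2), of "fps_X ^ n"] x(2) y(1) by simp
    qed
    have "x \<in> dual_sat" by (rule dual_satI) (simp_all add: x(1) key)
    from 0[OF this] have "residue x u = 0" .
    moreover obtain y n where y: "y \<in> carrier M" "u = frac y n"
      using sat_L[OF u] by (rule carrier_L_cases)
    ultimately show ?thesis
      using key[OF y(1)] u residue_frac[OF x(1) y(1)] by (simp add: fps_X_power_mult_nth)
  qed
  define v where "v = (\<Oplus>\<^bsub>L\<^esub>i\<in>I. fps_shift 1 (c i u) \<odot>\<^bsub>L\<^esub> s i)"
  have sum_sat: "(\<Oplus>\<^bsub>L\<^esub>i\<in>J. fps_shift 1 (c i u) \<odot>\<^bsub>L\<^esub> s i) \<in> sat" if "finite J" "J \<subseteq> I" for J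
    using that
  proof (induction J rule: finite_induct)
    case empty
    show ?case using frac_sat[of \<zero>] by (simp add: zero_L)
  next
    case (insert j J)
    then have "(\<Oplus>\<^bsub>L\<^esub>i\<in>insert j J. fps_shift 1 (c i u) \<odot>\<^bsub>L\<^esub> s i) =
        fps_shift 1 (c j u) \<odot>\<^bsub>L\<^esub> s j \<oplus>\<^bsub>L\<^esub> (\<Oplus>\<^bsub>L\<^esub>i\<in>J. fps_shift 1 (c i u) \<odot>\<^bsub>L\<^esub> s i)"
      using s sat_L by (intro L.M.finsum_insert) auto
    then show ?case using insert s by (simp add: sat_add sat_smult)
  qed
  have "u = (\<Oplus>\<^bsub>L\<^esub>i\<in>I. c i u \<odot>\<^bsub>L\<^esub> s i)" by (rule gen[OF u, symmetric])
  also have "\<dots> = (\<Oplus>\<^bsub>L\<^esub>i\<in>I. fps_X \<odot>\<^bsub>L\<^esub> (fps_shift 1 (c i u) \<odot>\<^bsub>L\<^esub> s i))"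
  proof (rule L.M.finsum_cong')
    fix i assume i: "i \<in> I"
    have "c i u = fps_X * fps_shift 1 (c i u)"
      by (rule fps_ext) (use c0[OF i] in \<open>auto simp: fps_X_mult_nth\<close>)
    then show "c i u \<odot>\<^bsub>L\<^esub> s i = fps_X \<odot>\<^bsub>L\<^esub> (fps_shift 1 (c i u) \<odot>\<^bsub>L\<^esub> s i)"
      using sat_L[OF s[OF i]] by (simp add: L.sm_assoc)
  qed (use s sat_L in auto)
  also have "\<dots> = fps_X \<odot>\<^bsub>L\<^esub> v"
    unfolding v_def by (rule L.finsum_smult_ldistr[symmetric]) (use I s sat_L in auto)
  finally show ?thesis using sum_sat[OF I] unfolding v_def by blast
qed

lemma residue_binva:
  assumes x: "x \<in> carrier M" and x': "x' \<in> carrier M" "fps_X \<odot>\<^bsub>M\<^esub> x' = aop M x" and u: "u \<in> carrier L"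
  shows "residue x' u + residue x (binva L u) = \<delta> * residue x u"
proof -
  obtain y n where y: "y \<in> carrier M" "u = frac y n"
    using u by (rule carrier_L_cases)
  have "k x (aop_frac y n) = fps_X * (fps_const \<delta> * k x y - k x' y - of_nat n * k x y + fps_X * fps_deriv (k x y))"
    using x x' y(1) by (simp add: k_aop_frac k_aop x'(2)[symmetric] k_X_left algebra_simps power2_eq_square)
  then have "k x (aop_frac y n) $ Suc n = \<delta> * k x y $ n - k x' y $ n - of_nat n * k x y $ n + (fps_X * fps_deriv (k x y)) $ n"
    by (simp add: fps_of_nat[symmetric])
  \<comment> \<open>Differentiation contributes \<open>n\<close> times the coefficient and cancels
    the correction for the denominator: \<open>b d/db\<close> kills the constant term of a Laurent
    series.\<close>
  moreover have "(fps_X * fps_deriv (k x y)) $ n = of_nat n * k x y $ n"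
    by (cases n) (simp_all add: fps_X_mult_nth)
  ultimately show ?thesis
    using x x'(1) y by (simp add: residue_frac binva_frac)
qed

lemma mod_b_duality_residue:
  "mod_b_duality (M\<lparr>carrier := dual_sat\<rparr>) (saturation M) residue \<delta>"
proof -
  interpret N: simple_pole_module "M\<lparr>carrier := dual_sat\<rparr>" by (rule simple_pole_dual_sat)
  interpret S: simple_pole_module "saturation M" by (rule simple_pole_saturation)
  have S: "carrier (saturation M) = sat" "\<And>f u. f \<odot>\<^bsub>saturation M\<^esub> u = f \<odot>\<^bsub>L\<^esub> u"
    "\<And>u v. u \<oplus>\<^bsub>saturation M\<^esub> v = u \<oplus>\<^bsub>L\<^esub> v"
    by (simp_all add: saturation_eq)
  show ?thesis
  proof (intro mod_b_duality.intro mod_b_duality_axioms.intro)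
    fix x x' u assume "x \<in> carrier (M\<lparr>carrier := dual_sat\<rparr>)" "x' \<in> carrier (M\<lparr>carrier := dual_sat\<rparr>)"
      "u \<in> carrier (saturation M)"
    then have *: "x \<in> carrier M" "x' \<in> carrier M" "u \<in> carrier L"
      using dual_sat_carrier sat_L by (simp_all add: S)
    obtain y n where y: "y \<in> carrier M" "u = frac y n" using *(3) by (rule carrier_L_cases)
    show "residue (x \<oplus>\<^bsub>M\<lparr>carrier := dual_sat\<rparr>\<^esub> x') u = residue x u + residue x' u"
      using * y by (simp add: residue_frac k_add_left)
  next
    fix x u v assume "x \<in> carrier (M\<lparr>carrier := dual_sat\<rparr>)"
      "u \<in> carrier (saturation M)" "v \<in> carrier (saturation M)"
    then have *: "x \<in> carrier M" "u \<in> carrier L" "v \<in> carrier L"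
      using dual_sat_carrier sat_L by (simp_all add: S)
    obtain y n where y: "y \<in> carrier M" "u = frac y n" using *(2) by (rule carrier_L_cases)
    obtain z m where z: "z \<in> carrier M" "v = frac z m" using *(3) by (rule carrier_L_cases)
    have "(fps_X ^ m * k x y + fps_X ^ n * k x z) $ (n + m) = k x y $ n + k x z $ m"
      by (simp add: fps_X_power_mult_nth)
    then show "residue x (u \<oplus>\<^bsub>saturation M\<^esub> v) = residue x u + residue x v"
      using *(1) y z by (simp add: S residue_frac frac_add k_add_right k_smult_right)
  next
    fix x u f assume "x \<in> carrier (M\<lparr>carrier := dual_sat\<rparr>)" "u \<in> carrier (saturation M)"
    then have x: "x \<in> dual_sat" and u: "u \<in> sat" by (simp_all add: S)
    note xM = dual_sat_carrier[OF x]
    obtain y n where y: "y \<in> carrier M" "u = frac y n" using sat_L[OF u] by (rule carrier_L_cases)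
    \<comment> \<open>Integrality makes the residue linear modulo \<open>b\<close>: the
      \<open>n\<close>-th coefficient of a product is the product of lowest terms only if the
      coefficients below \<open>n\<close> vanish.\<close>
    have d: "fps_X ^ n dvd k x y" using dual_satD[OF x y(1)] u y(2) by simp
    show "residue (f \<odot>\<^bsub>M\<lparr>carrier := dual_sat\<rparr>\<^esub> x) u = f $ 0 * residue x u"
      using xM y d by (simp add: residue_frac k_smult_left nth_mult_of_X_power_dvd)
    show "residue x (f \<odot>\<^bsub>saturation M\<^esub> u) = f $ 0 * residue x u"
      using xM y d by (simp add: S residue_frac frac_smult k_smult_right nth_mult_of_X_power_dvd)
    have "binva (M\<lparr>carrier := dual_sat\<rparr>) x \<in> dual_sat"
      "fps_X \<odot>\<^bsub>M\<^esub> binva (M\<lparr>carrier := dual_sat\<rparr>) x = aop M x"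
      using N.binva_closed[of x] N.X_binva[of x] x by simp_all
    then show "residue (binva (M\<lparr>carrier := dual_sat\<rparr>) x) u + residue x (binva (saturation M) u) = \<delta> * residue x u"
      unfolding binva_saturation[OF u] using residue_binva[OF xM] dual_sat_carrier sat_L[OF u] by simp
  next
    fix x assume "x \<in> carrier (M\<lparr>carrier := dual_sat\<rparr>)" "\<And>u. u \<in> carrier (saturation M) \<Longrightarrow> residue x u = 0"
    then show "\<exists>x'\<in>carrier (M\<lparr>carrier := dual_sat\<rparr>). x = fps_X \<odot>\<^bsub>M\<lparr>carrier := dual_sat\<rparr>\<^esub> x'"
      using residue_nondegenerate_left[of x] by (simp add: S)
  next
    fix u assume "u \<in> carrier (saturation M)" "\<And>x. x \<in> carrier (M\<lparr>carrier := dual_sat\<rparr>) \<Longrightarrow> residue x u = 0"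
    then show "\<exists>u'\<in>carrier (saturation M). u = fps_X \<odot>\<^bsub>saturation M\<^esub> u'"
      using residue_nondegenerate_right[of u] by (simp add: S)
  next
    \<comment> \<open>Finite generation comes from E, whose coordinates restrict to the
      submodule.\<close>
    have "submodule dual_sat Cb (M\<lparr>carrier := dual_sat\<rparr>)"
      using N.carrier_is_submodule by simp
    from N.ex_dual_system[OF finite_coord_index this, of coord]
    have "\<exists>s c. N.dual_system coord_index dual_sat s c"
      using dual_sat_carrier coord_eq_0 by simp
    then show "\<exists>I s c. finite (I :: nat set) \<and> N.dual_system I (carrier (M\<lparr>carrier := dual_sat\<rparr>)) s c"
      by (intro exI[of _ coord_index]) simp
  qed (rule N.simple_pole_module_axioms, rule S.simple_pole_module_axioms)
qed

theorem dual_bernstein_poly_eq: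
  "dual_bernstein_poly M =
    Polynomial.smult ((- 1) ^ Polynomial.degree (bernstein_poly M)) (pcompose (bernstein_poly M) [:- \<delta>, - 1:])"
  unfolding dual_bernstein_poly_def bernstein_poly_def biggest_simple_pole_eq
  by (rule mod_b_duality.residue_poly_reflect[OF mod_b_duality_residue])

end

section \<open>Self-dual modules\<close>

lemma abelian_group_E_rank1: "abelian_group (E_rank1 \<delta>)"
  by (rule abelian_groupI) (auto simp: E_rank1_def intro: exI[of _ "- _"])

lemma E_rank1_simps [simp]:
  "carrier (E_rank1 \<delta>) = UNIV" "f \<oplus>\<^bsub>E_rank1 \<delta>\<^esub> g = f + g" "f \<odot>\<^bsub>E_rank1 \<delta>\<^esub> g = f * g"
  "aop (E_rank1 \<delta>) f = fps_const \<delta> * fps_X * f + fps_X\<^sup>2 * fps_deriv f"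
  by (simp_all add: E_rank1_def)

lemma E_rank1_minus: "f \<ominus>\<^bsub>E_rank1 \<delta>\<^esub> g = f - g"
proof -
  interpret abelian_group "E_rank1 \<delta>" by (rule abelian_group_E_rank1)
  have "\<ominus>\<^bsub>E_rank1 \<delta>\<^esub> g = - g"
    by (rule minus_equality) (simp_all, simp add: E_rank1_def)
  then show ?thesis by (simp add: a_minus_def)
qed

lemma ab_duality_of_iso:
  assumes M: "ab_module E" and reg: "regular E"
    and \<kappa>: "\<kappa> \<in> ab_iso (check E) (Hom_ab E (E_rank1 \<delta>))"
  shows "ab_duality E \<kappa> \<delta>"
proof -
  interpret ab_module E by (rule M)
  let ?H = "Hom_ab E (E_rank1 \<delta>)"
  have bij: "bij_betw \<kappa> (carrier E) (carrier ?H)"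
    using \<kappa> by (simp add: ab_iso_def check_def)
  have hom: "\<kappa> x \<in> carrier ?H" if "x \<in> carrier E" for x
    using bij that by (rule bij_betwE[THEN bspec])
  have \<kappa>_add: "\<kappa> (x \<oplus>\<^bsub>E\<^esub> x') = \<kappa> x \<oplus>\<^bsub>?H\<^esub> \<kappa> x'" if "x \<in> carrier E" "x' \<in> carrier E" for x x'
    using \<kappa> that by (simp add: ab_iso_def ab_hom_def Cb_hom_def check_def)
  have \<kappa>_smult: "\<kappa> (fps_compose f (- fps_X) \<odot>\<^bsub>E\<^esub> x) = f \<odot>\<^bsub>?H\<^esub> \<kappa> x" if "x \<in> carrier E" for f x
    using \<kappa> that by (simp add: ab_iso_def ab_hom_def Cb_hom_def check_def)
  have \<kappa>_aop: "\<kappa> (\<ominus>\<^bsub>E\<^esub> aop E x) = aop ?H (\<kappa> x)" if "x \<in> carrier E" for x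
    using \<kappa> that by (simp add: ab_iso_def ab_hom_def Cb_hom_def check_def)
  have add: "\<kappa> (x \<oplus>\<^bsub>E\<^esub> x') y = \<kappa> x y + \<kappa> x' y"
    if "x \<in> carrier E" "x' \<in> carrier E" "y \<in> carrier E" for x x' y
    using \<kappa>_add[OF that(1,2)] that(3) by (simp add: Hom_ab_def)
  have smult: "\<kappa> (f \<odot>\<^bsub>E\<^esub> x) y = fps_compose f (- fps_X) * \<kappa> x y"
    if "x \<in> carrier E" "y \<in> carrier E" for f x y
  proof -
    \<comment> \<open>As \<open>b |-> -b\<close> is an involution, inserting \<open>f(-b)\<close>
      into the linearity of \<open>\<kappa>\<close> over \<open>check E\<close> yields the action of
      \<open>f\<close> itself.\<close>
    have "fps_compose (fps_compose f (- fps_X)) (- fps_X) = f"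
      by (subst fps_compose_assoc[symmetric]) (simp_all add: fps_compose_uminus)
    then show ?thesis
      using \<kappa>_smult[OF that(1), of "fps_compose f (- fps_X)"] that(2) by (simp add: Hom_ab_def)
  qed
  show ?thesis
  proof (intro ab_duality.intro ab_duality_axioms.intro)
    fix x y assume xy: "x \<in> carrier E" "y \<in> carrier E"
    have "\<kappa> (\<ominus>\<^bsub>E\<^esub> aop E x) y = - \<kappa> (aop E x) y"
    proof -
      have "fps_compose (- 1) (- fps_X) = (- 1 :: complex fps)"
        by (simp add: fps_compose_uminus)
      then show ?thesis using xy by (simp add: sm_neg_one smult)
    qed
    then show "\<kappa> x (aop E y) = \<kappa> (aop E x) y + fps_const \<delta> * fps_X * \<kappa> x y + fps_X\<^sup>2 * fps_deriv (\<kappa> x y)"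
      using fun_cong[OF \<kappa>_aop[OF xy(1)], of y] xy(2)
      by (simp add: Hom_ab_def E_rank1_minus algebra_simps)
  next
    fix x x' assume xx: "x \<in> carrier E" "x' \<in> carrier E" and eq: "\<And>y. y \<in> carrier E \<Longrightarrow> \<kappa> x y = \<kappa> x' y"
    have "\<kappa> x = \<kappa> x'"
      by (rule extensionalityI[of _ "carrier E"]) (use hom xx eq in \<open>simp_all add: Hom_ab_def\<close>)
    then show "x = x'" using bij_betw_imp_inj_on[OF bij] xx by (simp add: inj_on_eq_iff)
  next
    fix h assume h: "\<And>y y'. y \<in> carrier E \<Longrightarrow> y' \<in> carrier E \<Longrightarrow> h (y \<oplus>\<^bsub>E\<^esub> y') = h y + h y'"
      "\<And>f y. y \<in> carrier E \<Longrightarrow> h (f \<odot>\<^bsub>E\<^esub> y) = f * h y"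
    \<comment> \<open>\<open>Hom_ab\<close> contains extensional functions only, hence the
      restriction.\<close>
    have "restrict h (carrier E) \<in> carrier ?H"
      using h by (simp add: Hom_ab_def Cb_hom_def)
    then obtain x where "x \<in> carrier E" "\<kappa> x = restrict h (carrier E)"
      using bij_betw_imp_surj_on[OF bij] by (metis imageE)
    then show "\<exists>x\<in>carrier E. \<forall>y\<in>carrier E. \<kappa> x y = h y" by (intro bexI[of _ x]) simp_all
  qed (use hom M reg add smult in \<open>simp_all add: Hom_ab_def Cb_hom_def\<close>)
qed

theorem mainTheorem5:
  fixes \<delta> :: complex and E :: "'e ab_struct" and \<kappa> :: "'e \<Rightarrow> 'e \<Rightarrow> complex fps"
  assumes "ab_module E" and "regular E"
    and "\<kappa> \<in> ab_iso (check E) (Hom_ab E (E_rank1 \<delta>))"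
  shows "dual_bernstein_poly E =
    Polynomial.smult ((-1) ^ degree (bernstein_poly E)) (pcompose (bernstein_poly E) [:- \<delta>, -1:])"
  by (rule ab_duality.dual_bernstein_poly_eq[OF ab_duality_of_iso[OF assms]])

end
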